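(* Every $\mathrm{CPC}^*$-system has a $C^*$-encoding subsystem.
   Context: A map is c.p.c. if it is completely positive and contractive. A c.p.c. system $(F_n,\rho_{n+1,n})_n$ consists of $C^*$-algebras $(F_n)_{n\ge0}$ and c.p.c. maps $\rho_{n+1,n}\colon F_n\to F_{n+1}$; it is finite-dimensional if all $F_n$ are finite-dimensional. For $m>n$ set $\rho_{m,n}=\rho_{m,m-1}\circ\cdots\circ\rho_{n+1,n}$ and $\rho_{n,n}=\mathrm{id}_{F_n}$. A subsystem is a c.p.c. system of the form $(F_{n_i},\rho_{n_{i+1},n_i})_i$ with $(n_i)_i$ strictly increasing. Below, "for all $m>n,j>M$" means for all $n,j>M$ and $m>\max\{n,j\}$. A finite-dimensional c.p.c. system $(F_n,\rho_{n+1,n})_n$ is a $\mathrm{CPC}^*$-system if for any $k\ge0$, $x,y\in F_k$ and $\varepsilon>0$ there is $M>k$ such that for all $m>n,j>M$, $$\|\rho_{m,k}(x)\rho_{m,k}(y)-\rho_{m,j}(1_{F_j})\rho_{m,n}(\rho_{n,k}(x)\rho_{n,k}(y))\|<\varepsilon .$$ A c.p.c. system $(F_n,\rho_{n+1,n})_n$ is $C^*$-encoding if for any $k\ge0$, $x,y\in F_k$ and $\varepsilon>0$ there is $M>k$ such that for all $m>n,j>M$, $$\|\rho_{m,n}(\rho_{n,k}(x)\rho_{n,k}(y))-\rho_{m,j}(\rho_{j,k}(x)\rho_{j,k}(y))\|<\varepsilon .$$ *)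

theory Defs
  imports Complex_Main "HOL-Algebra.Module" "HOL-Algebra.Algebraic_Closure_Type"
begin

text \<open>
  \<open>C\<^sup>*\<close>-algebras are carrier-based, so that the members of one system may be different algebras.
  They are not assumed to be unital: the field \<open>one\<close> that the records inherit from HOL-Algebra
  is unconstrained and never used; \<open>alg_unit\<close> below is the unit.
\<close>

record 'a star_alg = "(complex, 'a) module" +
  star :: "'a \<Rightarrow> 'a"

record 'a normed_star_alg = "'a star_alg" +
  cnorm :: "'a \<Rightarrow> real"

abbreviation complex_ring :: "complex ring" where
  "complex_ring \<equiv> ring_of_type_algebra"

locale cstar_algebra = module complex_ring A for A :: "('a, 'm) normed_star_alg_scheme" (structure) +
  assumes mult_closed: "\<lbrakk>x \<in> carrier A; y \<in> carrier A\<rbrakk> \<Longrightarrow> x \<otimes> y \<in> carrier A"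
    and mult_assoc:
      "\<lbrakk>x \<in> carrier A; y \<in> carrier A; z \<in> carrier A\<rbrakk> \<Longrightarrow> (x \<otimes> y) \<otimes> z = x \<otimes> (y \<otimes> z)"
    and mult_l_distr:
      "\<lbrakk>x \<in> carrier A; y \<in> carrier A; z \<in> carrier A\<rbrakk> \<Longrightarrow> (x \<oplus> y) \<otimes> z = x \<otimes> z \<oplus> y \<otimes> z"
    and mult_r_distr:
      "\<lbrakk>x \<in> carrier A; y \<in> carrier A; z \<in> carrier A\<rbrakk> \<Longrightarrow> z \<otimes> (x \<oplus> y) = z \<otimes> x \<oplus> z \<otimes> y"
    and smult_mult_l: "\<lbrakk>x \<in> carrier A; y \<in> carrier A\<rbrakk> \<Longrightarrow> (c \<odot> x) \<otimes> y = c \<odot> (x \<otimes> y)"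
    and smult_mult_r: "\<lbrakk>x \<in> carrier A; y \<in> carrier A\<rbrakk> \<Longrightarrow> x \<otimes> (c \<odot> y) = c \<odot> (x \<otimes> y)"
    and star_closed: "x \<in> carrier A \<Longrightarrow> star A x \<in> carrier A"
    and star_star: "x \<in> carrier A \<Longrightarrow> star A (star A x) = x"
    and star_add:
      "\<lbrakk>x \<in> carrier A; y \<in> carrier A\<rbrakk> \<Longrightarrow> star A (x \<oplus> y) = star A x \<oplus> star A y"
    and star_smult: "x \<in> carrier A \<Longrightarrow> star A (c \<odot> x) = cnj c \<odot> star A x"
    and star_mult:
      "\<lbrakk>x \<in> carrier A; y \<in> carrier A\<rbrakk> \<Longrightarrow> star A (x \<otimes> y) = star A y \<otimes> star A x"
    and cnorm_nonneg: "x \<in> carrier A \<Longrightarrow> 0 \<le> cnorm A x"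
    and cnorm_eq_0_iff: "x \<in> carrier A \<Longrightarrow> cnorm A x = 0 \<longleftrightarrow> x = \<zero>"
    and cnorm_triangle:
      "\<lbrakk>x \<in> carrier A; y \<in> carrier A\<rbrakk> \<Longrightarrow> cnorm A (x \<oplus> y) \<le> cnorm A x + cnorm A y"
    and cnorm_smult: "x \<in> carrier A \<Longrightarrow> cnorm A (c \<odot> x) = cmod c * cnorm A x"
    and cnorm_mult:
      "\<lbrakk>x \<in> carrier A; y \<in> carrier A\<rbrakk> \<Longrightarrow> cnorm A (x \<otimes> y) \<le> cnorm A x * cnorm A y"
    and cnorm_star_mult: "x \<in> carrier A \<Longrightarrow> cnorm A (star A x \<otimes> x) = (cnorm A x)\<^sup>2"
    and complete:
      "\<lbrakk>\<forall>n::nat. u n \<in> carrier A;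
        \<forall>e>0. \<exists>N. \<forall>m\<ge>N. \<forall>n\<ge>N. cnorm A (u m \<ominus> u n) < e\<rbrakk>
       \<Longrightarrow> \<exists>x\<in>carrier A. (\<lambda>n. cnorm A (u n \<ominus> x)) \<longlonglongrightarrow> 0"

definition finite_dim :: "('a, 'm) normed_star_alg_scheme \<Rightarrow> bool" where
  "finite_dim A \<longleftrightarrow>
     (\<exists>B. finite B \<and> B \<subseteq> carrier A \<and>
        (\<forall>x\<in>carrier A. \<exists>c. x = (\<Oplus>\<^bsub>A\<^esub>b\<in>B. c b \<odot>\<^bsub>A\<^esub> b)))"

text \<open>Only meaningful for unital \<open>A\<close>; every finite-dimensional \<open>C\<^sup>*\<close>-algebra is unital.\<close>
definition alg_unit :: "('a, 'm) normed_star_alg_scheme \<Rightarrow> 'a" where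
  "alg_unit A =
     (THE e. e \<in> carrier A \<and> (\<forall>x\<in>carrier A. e \<otimes>\<^bsub>A\<^esub> x = x \<and> x \<otimes>\<^bsub>A\<^esub> e = x))"

text \<open>
  The $*$-algebra \<open>M\<^sub>r(A)\<close>. Matrices are indexed by \<open>{..<r}\<close> and vanish outside, which makes their
  representation unique. Its \<open>C\<^sup>*\<close>-norm is not needed to say which elements are positive.
\<close>
definition mat_alg :: "nat \<Rightarrow> ('a, 'm) star_alg_scheme \<Rightarrow> (nat \<Rightarrow> nat \<Rightarrow> 'a) star_alg" where
  "mat_alg r A =
     \<lparr>carrier = {a. \<forall>i j. if i < r \<and> j < r then a i j \<in> carrier A else a i j = \<zero>\<^bsub>A\<^esub>},
      monoid.mult = (\<lambda>a b i j. if i < r \<and> j < r then (\<Oplus>\<^bsub>A\<^esub>l\<in>{..<r}. a i l \<otimes>\<^bsub>A\<^esub> b l j) else \<zero>\<^bsub>A\<^esub>),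
      one = (\<lambda>i j. if i < r \<and> i = j then \<one>\<^bsub>A\<^esub> else \<zero>\<^bsub>A\<^esub>),
      zero = (\<lambda>i j. \<zero>\<^bsub>A\<^esub>),
      add = (\<lambda>a b i j. if i < r \<and> j < r then a i j \<oplus>\<^bsub>A\<^esub> b i j else \<zero>\<^bsub>A\<^esub>),
      module.smult = (\<lambda>c a i j. if i < r \<and> j < r then c \<odot>\<^bsub>A\<^esub> a i j else \<zero>\<^bsub>A\<^esub>),
      star = (\<lambda>a i j. if i < r \<and> j < r then star A (a j i) else \<zero>\<^bsub>A\<^esub>)\<rparr>"

definition positive_elems :: "('a, 'm) star_alg_scheme \<Rightarrow> 'a set" where
  "positive_elems A = {star A b \<otimes>\<^bsub>A\<^esub> b | b. b \<in> carrier A}"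

definition linear_map ::
  "('a, 'm) star_alg_scheme \<Rightarrow> ('b, 'n) star_alg_scheme \<Rightarrow> ('a \<Rightarrow> 'b) \<Rightarrow> bool" where
  "linear_map A B \<phi> \<longleftrightarrow>
     \<phi> \<in> carrier A \<rightarrow> carrier B \<and>
     (\<forall>x\<in>carrier A. \<forall>y\<in>carrier A. \<phi> (x \<oplus>\<^bsub>A\<^esub> y) = \<phi> x \<oplus>\<^bsub>B\<^esub> \<phi> y) \<and>
     (\<forall>c. \<forall>x\<in>carrier A. \<phi> (c \<odot>\<^bsub>A\<^esub> x) = c \<odot>\<^bsub>B\<^esub> \<phi> x)"

text \<open>The entrywise application of \<open>\<phi>\<close> is the amplification \<open>M\<^sub>r(A) \<rightarrow> M\<^sub>r(B)\<close>; recall \<open>\<phi> \<zero> = \<zero>\<close>.\<close>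
definition completely_positive ::
  "('a, 'm) star_alg_scheme \<Rightarrow> ('b, 'n) star_alg_scheme \<Rightarrow> ('a \<Rightarrow> 'b) \<Rightarrow> bool" where
  "completely_positive A B \<phi> \<longleftrightarrow>
     linear_map A B \<phi> \<and>
     (\<forall>r. \<forall>a\<in>positive_elems (mat_alg r A). (\<lambda>i j. \<phi> (a i j)) \<in> positive_elems (mat_alg r B))"

definition cpc_map ::
  "('a, 'm) normed_star_alg_scheme \<Rightarrow> ('b, 'n) normed_star_alg_scheme \<Rightarrow> ('a \<Rightarrow> 'b) \<Rightarrow> bool" where
  "cpc_map A B \<phi> \<longleftrightarrow>
     completely_positive A B \<phi> \<and> (\<forall>x\<in>carrier A. cnorm B (\<phi> x) \<le> cnorm A x)"

text \<open>
  In a system \<open>(F, \<rho>)\<close>, the map \<open>\<rho> n\<close> is $\rho_{n+1,n}$. All carriers live in one type \<open>'a\<close>; this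
  is no restriction, as \<open>'a\<close> is arbitrary and may be a disjoint union.
\<close>
definition cpc_system ::
  "(nat \<Rightarrow> ('a, 'm) normed_star_alg_scheme) \<Rightarrow> (nat \<Rightarrow> 'a \<Rightarrow> 'a) \<Rightarrow> bool" where
  "cpc_system F \<rho> \<longleftrightarrow> (\<forall>n. cstar_algebra (F n) \<and> cpc_map (F n) (F (Suc n)) (\<rho> n))"

text \<open>\<open>connecting \<rho> m n\<close> is $\rho_{m,n}$ for $m \ge n$ (and the identity, unused, for $m < n$).\<close>
primrec connecting :: "(nat \<Rightarrow> 'a \<Rightarrow> 'a) \<Rightarrow> nat \<Rightarrow> nat \<Rightarrow> 'a \<Rightarrow> 'a" where
  "connecting \<rho> 0 n = id"
| "connecting \<rho> (Suc m) n = (if n \<le> m then \<rho> m \<circ> connecting \<rho> m n else id)"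

definition CPC_star_system ::
  "(nat \<Rightarrow> ('a, 'm) normed_star_alg_scheme) \<Rightarrow> (nat \<Rightarrow> 'a \<Rightarrow> 'a) \<Rightarrow> bool" where
  "CPC_star_system F \<rho> \<longleftrightarrow>
     cpc_system F \<rho> \<and> (\<forall>n. finite_dim (F n)) \<and>
     (\<forall>k. \<forall>x\<in>carrier (F k). \<forall>y\<in>carrier (F k). \<forall>\<epsilon>>0. \<exists>M>k. \<forall>n>M. \<forall>j>M. \<forall>m>max n j.
        cnorm (F m)
          (connecting \<rho> m k x \<otimes>\<^bsub>F m\<^esub> connecting \<rho> m k y
           \<ominus>\<^bsub>F m\<^esub> connecting \<rho> m j (alg_unit (F j))
              \<otimes>\<^bsub>F m\<^esub> connecting \<rho> m n (connecting \<rho> n k x \<otimes>\<^bsub>F n\<^esub> connecting \<rho> n k y)) < \<epsilon>)"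

definition Cstar_encoding ::
  "(nat \<Rightarrow> ('a, 'm) normed_star_alg_scheme) \<Rightarrow> (nat \<Rightarrow> 'a \<Rightarrow> 'a) \<Rightarrow> bool" where
  "Cstar_encoding F \<rho> \<longleftrightarrow>
     cpc_system F \<rho> \<and>
     (\<forall>k. \<forall>x\<in>carrier (F k). \<forall>y\<in>carrier (F k). \<forall>\<epsilon>>0. \<exists>M>k. \<forall>n>M. \<forall>j>M. \<forall>m>max n j.
        cnorm (F m)
          (connecting \<rho> m n (connecting \<rho> n k x \<otimes>\<^bsub>F n\<^esub> connecting \<rho> n k y)
           \<ominus>\<^bsub>F m\<^esub> connecting \<rho> m j (connecting \<rho> j k x \<otimes>\<^bsub>F j\<^esub> connecting \<rho> j k y)) < \<epsilon>)"

end

theory Submission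
  imports Defs "Jordan_Normal_Form.Spectral_Radius"
begin

text \<open>
  A CPC*-system is already \<open>C\<^sup>*\<close>-encoding, so the whole system serves as the subsystem. For a
  c.p.c. map \<open>\<phi>\<close> and \<open>d = \<phi> f\<close>, \<open>e = \<phi> 1\<close>, positivity of the image of the matrix with rows
  \<open>(1, f)\<close> and \<open>(f\<^sup>*, f\<^sup>*f)\<close> gives $\|d\|^3 \le 4 \|f\|^2 \|e d\|$. For \<open>n \<le> j\<close> and
  $\phi = \rho_{m,j}$ the CPC*-condition makes \<open>e d\<close> small when \<open>d\<close> is the difference of the two
  products, while \<open>f\<close> stays bounded.

  The estimate rests on $\|u\|^2 \le \|u^*u + v^*v\|$. In finite dimension the trace of the left
  regular representation is a faithful positive functional: left multiplication by a selfadjoint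
  element has real eigenvalues, because $x^*hx$ is selfadjoint and $x^*x \ne 0$. The norm of a
  selfadjoint element is the spectral radius of its left multiplication, by
  $\|h^{2^n}\| = \|h\|^{2^n}$, so eigenvalues can be compared through the trace.
\<close>

text \<open>For \<open>t < a\<close> the ratio \<open>(a / t) ^ 2 ^ n\<close> is unbounded, so no
  constant \<open>C\<close> absorbs it. The exponents are powers of two because the C*-identity and
  Cauchy-Schwarz each double an exponent.\<close>

lemma le_if_dyadic_powers_le:
  fixes a t C :: real
  assumes "0 \<le> t" and le: "\<And>n. a ^ (2 ^ n) \<le> C * t ^ (2 ^ n)"
  shows "a \<le> t"
proof (rule ccontr)
  assume "\<not> a \<le> t"
  then have "t < a" by simp
  show False
  proof (cases "t = 0")
    case True
    then show False using le[of 0] \<open>t < a\<close> by simp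
  next
    case False
    with assms have "t > 0" by simp
    then have gt: "a / t > 1" using \<open>t < a\<close> by simp
    obtain k where k: "C < (a / t) ^ k" using real_arch_pow[OF gt] by blast
    have "(a / t) ^ k \<le> (a / t) ^ (2 ^ k)"
      using gt by (intro power_increasing) (auto intro: less_imp_le less_exp)
    with k have "C < (a / t) ^ (2 ^ k)" by simp
    also have "\<dots> \<le> C" using le[of k] \<open>t > 0\<close> by (simp add: power_divide field_simps)
    finally show False by simp
  qed
qed

section \<open>Traces and powers of complex matrices\<close>

lemma linear_vec_eq_mult_mat_vec:
  fixes F :: "complex vec \<Rightarrow> complex vec"
  assumes cl: "\<And>v. v \<in> carrier_vec n \<Longrightarrow> F v \<in> carrier_vec k"
    and add: "\<And>v w. v \<in> carrier_vec n \<Longrightarrow> w \<in> carrier_vec n \<Longrightarrow> F (v + w) = F v + F w"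
    and smult: "\<And>c v. v \<in> carrier_vec n \<Longrightarrow> F (c \<cdot>\<^sub>v v) = c \<cdot>\<^sub>v F v"
    and v: "v \<in> carrier_vec n"
  shows "F v = mat k n (\<lambda>(i, j). F (unit_vec n j) $ i) *\<^sub>v v"
proof -
  let ?M = "mat k n (\<lambda>(i, j). F (unit_vec n j) $ i)"
  \<comment> \<open>\<open>tr l\<close> keeps the first \<open>l\<close> coordinates of
    \<open>v\<close>; the induction adds one basis vector at a time and reaches \<open>v\<close> at
    \<open>l = n\<close>.\<close>
  define tr where "tr l = vec n (\<lambda>i. if i < l then v $ i else 0)" for l
  have tr_carrier: "tr l \<in> carrier_vec n" for l by (simp add: tr_def)
  have "l \<le> n \<Longrightarrow> F (tr l) = ?M *\<^sub>v tr l" for l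
  proof (induction l)
    case 0
    have tr0: "tr 0 = 0 \<cdot>\<^sub>v 0\<^sub>v n" by (intro eq_vecI) (auto simp: tr_def)
    have "F (tr 0) = 0 \<cdot>\<^sub>v F (0\<^sub>v n)" unfolding tr0 by (rule smult) simp
    also have "\<dots> = 0\<^sub>v k" using cl[of "0\<^sub>v n"] by (intro eq_vecI) auto
    also have "\<dots> = ?M *\<^sub>v tr 0" by (intro eq_vecI) (auto simp: tr_def scalar_prod_def)
    finally show ?case .
  next
    case (Suc l)
    then have l: "l < n" by simp
    have dec: "tr (Suc l) = tr l + v $ l \<cdot>\<^sub>v unit_vec n l"
      by (intro eq_vecI) (use l in \<open>auto simp: tr_def less_Suc_eq\<close>)
    have col: "F (unit_vec n l) = ?M *\<^sub>v unit_vec n l"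
      using l cl[of "unit_vec n l"] by (intro eq_vecI) (auto simp: scalar_prod_right_unit)
    have "F (tr (Suc l)) = F (tr l) + v $ l \<cdot>\<^sub>v F (unit_vec n l)"
      unfolding dec using tr_carrier by (simp add: add smult)
    also have "\<dots> = ?M *\<^sub>v tr l + v $ l \<cdot>\<^sub>v (?M *\<^sub>v unit_vec n l)"
      using Suc col by simp
    also have "\<dots> = ?M *\<^sub>v tr (Suc l)"
      unfolding dec
      by (simp add: mult_add_distrib_mat_vec[of _ k n] mult_mat_vec[of _ k n] tr_carrier)
    finally show ?case .
  qed
  from this[of n] have "F (tr n) = ?M *\<^sub>v tr n" by simp
  moreover have "tr n = v" using v by (intro eq_vecI) (auto simp: tr_def)
  ultimately show ?thesis by simp
qed

definition mat_trace :: "complex mat \<Rightarrow> complex" where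
  "mat_trace M = (\<Sum>i<dim_row M. M $$ (i, i))"

lemma mat_trace_mult_commute:
  assumes "M \<in> carrier_mat n n" "L \<in> carrier_mat n n"
  shows "mat_trace (M * L) = mat_trace (L * M)"
proof -
  have "mat_trace (M * L) = (\<Sum>i<n. \<Sum>j<n. M $$ (i, j) * L $$ (j, i))"
    using assms by (auto simp: mat_trace_def scalar_prod_def lessThan_atLeast0 intro!: sum.cong)
  also have "\<dots> = (\<Sum>j<n. \<Sum>i<n. M $$ (i, j) * L $$ (j, i))" by (rule sum.swap)
  also have "\<dots> = mat_trace (L * M)"
    using assms by (auto simp: mat_trace_def scalar_prod_def lessThan_atLeast0 mult.commute intro!: sum.cong)
  finally show ?thesis .
qed

text \<open>\<open>f\<close> is the diagonal of a Schur triangular form \<open>B\<close>, so it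
  lists the eigenvalues with multiplicity. Similarity preserves both traces, and squaring a
  triangular matrix squares its diagonal.\<close>

lemma mat_trace_eigenvalues:
  assumes A: "A \<in> carrier_mat n n"
  obtains f where "{f i |i. i < n} = Collect (eigenvalue A)"
    and "mat_trace A = (\<Sum>i<n. f i)" and "mat_trace (A * A) = (\<Sum>i<n. (f i)\<^sup>2)"
proof -
  obtain as where as: "char_poly A = (\<Prod>a\<leftarrow>as. [:- a, 1:])"
    using char_poly_factorized[OF A] by blast
  obtain B where B: "B \<in> carrier_mat n n" "upper_triangular B" "similar_mat A B"
    using schur_decomposition_exists[OF A as] by blast
  obtain P Q where "similar_mat_wit A B P Q" using B(3) unfolding similar_mat_def by blast
  note w = similar_mat_witD2[OF A this]
  have trace_conj: "mat_trace (P * L * Q) = mat_trace L" if L: "L \<in> carrier_mat n n" for L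
  proof -
    have "mat_trace (P * L * Q) = mat_trace (P * (L * Q))"
      using w L by (simp add: assoc_mult_mat[of _ n n _ n _ n])
    also have "\<dots> = mat_trace (L * Q * P)"
      using w L by (intro mat_trace_mult_commute[of _ n]) auto
    also have "L * Q * P = L"
      using w L by (simp add: assoc_mult_mat[of _ n n _ n _ n])
    finally show ?thesis .
  qed
  have "A * A = (P * B * Q) * (P * B * Q)" using w by simp
  also have "\<dots> = P * B * (Q * P) * (B * Q)"
    using w(4-7) by (simp add: assoc_mult_mat[of _ n n _ n _ n] del: w(2))
  also have "\<dots> = P * (B * B) * Q"
    using w by (simp add: assoc_mult_mat[of _ n n _ n _ n])
  finally have "mat_trace (A * A) = mat_trace (B * B)" using trace_conj[of "B * B"] B by simp
  also have "\<dots> = (\<Sum>i<n. (B $$ (i, i))\<^sup>2)"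
  proof -
    \<comment> \<open>For \<open>j \<noteq> i\<close> one of the two entries lies below the diagonal
      of \<open>B\<close> and vanishes.\<close>
    have "(\<Sum>j<n. B $$ (i, j) * B $$ (j, i)) = (\<Sum>j\<in>{i}. B $$ (i, j) * B $$ (j, i))" if "i < n" for i
    proof (rule sum.mono_neutral_right)
      show "\<forall>j\<in>{..<n} - {i}. B $$ (i, j) * B $$ (j, i) = 0"
      proof
        fix j assume "j \<in> {..<n} - {i}"
        then consider "j < i" | "i < j" "j < n" by fastforce
        then show "B $$ (i, j) * B $$ (j, i) = 0"
          using B that by cases (auto dest: upper_triangularD)
      qed
    qed (use that in auto)
    then show ?thesis
      using B by (auto simp: mat_trace_def scalar_prod_def lessThan_atLeast0 power2_eq_square intro!: sum.cong)
  qed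
  finally have sq: "mat_trace (A * A) = (\<Sum>i<n. (B $$ (i, i))\<^sup>2)" .
  have tr: "mat_trace A = (\<Sum>i<n. B $$ (i, i))"
    using trace_conj[OF B(1)] w B by (simp add: mat_trace_def)
  have "eigenvalue A k \<longleftrightarrow> k \<in> {B $$ (i, i) |i. i < n}" for k
  proof -
    have "eigenvalue A k \<longleftrightarrow> poly (char_poly B) k = 0"
      using eigenvalue_root_char_poly[OF A] char_poly_similar[OF B(3)] by simp
    also have "\<dots> \<longleftrightarrow> k \<in> set (diag_mat B)"
      unfolding char_poly_upper_triangular[OF B(1,2)]
      by (auto simp: poly_prod_list prod_list_zero_iff)
    also have "\<dots> \<longleftrightarrow> k \<in> {B $$ (i, i) |i. i < n}"
      using B by (auto simp: diag_mat_def)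
    finally show ?thesis .
  qed
  then show ?thesis using that[of "\<lambda>i. B $$ (i, i)"] tr sq by blast
qed

text \<open>A spectral radius below 1 bounds the powers of every Jordan block. \<open>0 < n\<close>
  makes the spectrum nonempty, so that the spectral radius is attained by an eigenvalue.\<close>

lemma mat_power_bounded:
  assumes A: "A \<in> carrier_mat n n" and "0 < n"
    and ev: "\<And>k. eigenvalue A k \<Longrightarrow> cmod k < 1"
  obtains c where "\<And>k i j. i < n \<Longrightarrow> j < n \<Longrightarrow> cmod ((A ^\<^sub>m k) $$ (i, j)) \<le> c"
proof -
  have "spectral_radius A < 1"
    using spectral_radius_mem_max(1)[OF A \<open>0 < n\<close>] ev by (auto simp: spectrum_def)
  moreover have "\<exists>n_as. jordan_nf A n_as"
    using char_poly_factorized[OF A] jordan_nf_exists[OF A] by blast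
  ultimately obtain c where "\<forall>k. norm_bound (A ^\<^sub>m k) c"
    using spectral_radius_jnf_norm_bound_less_1[OF A] by blast
  then show ?thesis using that[of c] A by (auto simp: norm_bound_def)
qed

text \<open>Cramer's rule: a trivial kernel makes the determinant nonzero, and the adjugate divided
  by it is an inverse.\<close>

lemma solve_if_kernel_trivial:
  fixes G :: "complex mat"
  assumes G: "G \<in> carrier_mat n n" and b: "b \<in> carrier_vec n"
    and inj: "\<And>v. v \<in> carrier_vec n \<Longrightarrow> G *\<^sub>v v = 0\<^sub>v n \<Longrightarrow> v = 0\<^sub>v n"
  obtains v where "v \<in> carrier_vec n" "G *\<^sub>v v = b"
proof
  have det: "det G \<noteq> 0" using det_0_iff_vec_prod_zero[OF G] inj by blast
  let ?v = "(1 / det G) \<cdot>\<^sub>v (adj_mat G *\<^sub>v b)"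
  show "?v \<in> carrier_vec n" using adj_mat[OF G] b by auto
  have "G *\<^sub>v ?v = (1 / det G) \<cdot>\<^sub>v ((G * adj_mat G) *\<^sub>v b)"
    using adj_mat(1)[OF G] G b by (simp add: mult_mat_vec[of _ n n] assoc_mult_mat_vec[of _ n n _ n])
  also have "\<dots> = b"
    using det b by (simp add: adj_mat(2)[OF G]) (intro eq_vecI, auto simp: scalar_prod_left_unit)
  finally show "G *\<^sub>v ?v = b" .
qed

section \<open>Carrier-based $C^*$-algebras\<close>

lemma complex_ring_simps [simp]:
  "carrier complex_ring = UNIV"
  "\<zero>\<^bsub>complex_ring\<^esub> = 0" "\<one>\<^bsub>complex_ring\<^esub> = 1"
  "a \<oplus>\<^bsub>complex_ring\<^esub> b = a + b" "a \<otimes>\<^bsub>complex_ring\<^esub> b = a * b"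
  by (simp_all add: ring_of_type_algebra_def)

lemma complex_ring_minus [simp]: "\<ominus>\<^bsub>complex_ring\<^esub> a = - a"
proof -
  interpret field complex_ring by (rule field_from_type_algebra)
  have "- a \<oplus>\<^bsub>complex_ring\<^esub> a = \<zero>\<^bsub>complex_ring\<^esub>" by simp
  then show ?thesis by (rule minus_equality) simp_all
qed

context cstar_algebra
begin

declare mult_closed [simp, intro] star_closed [simp, intro] star_star [simp]

lemma scale_closed [simp, intro]: "x \<in> carrier A \<Longrightarrow> c \<odot> x \<in> carrier A"
  by (rule smult_closed) simp_all

lemma scale_add_left: "x \<in> carrier A \<Longrightarrow> (c + d) \<odot> x = c \<odot> x \<oplus> d \<odot> x"
  using smult_l_distr[of c d x] by simp

lemma scale_add_right: "x \<in> carrier A \<Longrightarrow> y \<in> carrier A \<Longrightarrow> c \<odot> (x \<oplus> y) = c \<odot> x \<oplus> c \<odot> y"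
  using smult_r_distr[of c x y] by simp

lemma scale_scale: "x \<in> carrier A \<Longrightarrow> c \<odot> (d \<odot> x) = (c * d) \<odot> x"
  using smult_assoc1[of c d x] by simp

lemma scale_one [simp]: "x \<in> carrier A \<Longrightarrow> 1 \<odot> x = x"
  using smult_one[of x] by simp

lemma scale_zero_left [simp]: "x \<in> carrier A \<Longrightarrow> 0 \<odot> x = \<zero>"
  using smult_l_null[of x] by simp

lemma scale_minus_one: "x \<in> carrier A \<Longrightarrow> (- 1) \<odot> x = \<ominus> x"
  using smult_l_minus[of 1 x] by simp

lemma diff_conv_scale: "x \<in> carrier A \<Longrightarrow> y \<in> carrier A \<Longrightarrow> x \<ominus> y = x \<oplus> (- 1) \<odot> y"
  by (simp add: a_minus_def scale_minus_one)

lemma cnorm_zero [simp]: "cnorm A \<zero> = 0"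
  using cnorm_eq_0_iff[of \<zero>] by simp

lemma cnorm_pos: "x \<in> carrier A \<Longrightarrow> x \<noteq> \<zero> \<Longrightarrow> 0 < cnorm A x"
  using cnorm_eq_0_iff[of x] cnorm_nonneg[of x] by linarith

lemma cnorm_diff_commute:
  assumes "x \<in> carrier A" "y \<in> carrier A"
  shows "cnorm A (x \<ominus> y) = cnorm A (y \<ominus> x)"
proof -
  have "y \<ominus> x = (- 1) \<odot> (x \<ominus> y)"
    using assms by (simp add: diff_conv_scale scale_add_right scale_scale a_comm)
  then show ?thesis using assms cnorm_smult[of "x \<ominus> y" "- 1"] by simp
qed

lemma cnorm_diff_triangle:
  assumes "x \<in> carrier A" "y \<in> carrier A"
  shows "cnorm A (x \<ominus> y) \<le> cnorm A x + cnorm A y"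
  using assms cnorm_triangle[of x "(- 1) \<odot> y"] by (simp add: diff_conv_scale cnorm_smult)

lemma scale_cancel_right:
  assumes "x \<in> carrier A" "x \<noteq> \<zero>" "c \<odot> x = d \<odot> x"
  shows "c = d"
proof -
  have "(c - d) \<odot> x = d \<odot> x \<oplus> (- 1) \<odot> (d \<odot> x)"
    using assms scale_add_left[of x c "- d"] by (simp add: scale_scale)
  also have "\<dots> = \<zero>" using assms by (simp add: scale_minus_one r_neg)
  finally have "cmod (c - d) * cnorm A x = 0" using assms cnorm_smult[of x "c - d"] by simp
  then show ?thesis using cnorm_pos[of x] assms by simp
qed

lemma mult_zero_left [simp]: "x \<in> carrier A \<Longrightarrow> \<zero> \<otimes> x = \<zero>"
  using smult_mult_l[of x x 0] by simp

lemma mult_zero_right [simp]: "x \<in> carrier A \<Longrightarrow> x \<otimes> \<zero> = \<zero>"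
  using smult_mult_r[of x x 0] by simp

lemma star_zero [simp]: "star A \<zero> = \<zero>"
  using star_smult[of \<zero> 0] by simp

lemma cnorm_star [simp]:
  assumes "x \<in> carrier A"
  shows "cnorm A (star A x) = cnorm A x"
proof -
  \<comment> \<open>The C*-identity with submultiplicativity yields this for every \<open>y\<close>;
    using it at \<open>x\<close> and at \<open>star A x\<close> gives equality.\<close>
  have le: "cnorm A y \<le> cnorm A (star A y)" if "y \<in> carrier A" for y
  proof (cases "y = \<zero>")
    case False
    have "(cnorm A y)\<^sup>2 \<le> cnorm A (star A y) * cnorm A y"
      using that cnorm_star_mult[of y] cnorm_mult[of "star A y" y] by simp
    then show ?thesis using cnorm_pos[OF that False] by (simp add: power2_eq_square)
  qed (use cnorm_nonneg[of "star A y"] that in simp)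
  show ?thesis using le[of x] le[of "star A x"] assms by simp
qed

lemma star_mult_self_eq_zero:
  assumes "x \<in> carrier A" "star A x \<otimes> x = \<zero>"
  shows "x = \<zero>"
  using cnorm_star_mult[of x] cnorm_eq_0_iff[of x] assms by simp

text \<open>As \<open>A\<close> need not have a unit, the power \<open>h\<^bsup>k+1\<^esup>\<close> is written \<open>((\<otimes>) h ^^ k) h\<close>.\<close>

lemma funpow_mult_closed [simp, intro]:
  "h \<in> carrier A \<Longrightarrow> x \<in> carrier A \<Longrightarrow> ((\<otimes>) h ^^ k) x \<in> carrier A"
  by (induction k) auto

lemma funpow_mult_mult:
  assumes "h \<in> carrier A" "x \<in> carrier A" "y \<in> carrier A"
  shows "((\<otimes>) h ^^ k) x \<otimes> y = ((\<otimes>) h ^^ k) (x \<otimes> y)"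
  using assms by (induction k) (auto simp: mult_assoc)

lemma power_add_Suc:
  assumes "h \<in> carrier A"
  shows "((\<otimes>) h ^^ i) h \<otimes> ((\<otimes>) h ^^ j) h = ((\<otimes>) h ^^ Suc (i + j)) h"
proof -
  have "((\<otimes>) h ^^ i) h \<otimes> ((\<otimes>) h ^^ j) h = ((\<otimes>) h ^^ i) (((\<otimes>) h ^^ Suc j) h)"
    using assms by (simp add: funpow_mult_mult)
  also have "\<dots> = ((\<otimes>) h ^^ (i + Suc j)) h" unfolding funpow_add comp_def ..
  finally show ?thesis by simp
qed

lemma star_power:
  assumes "h \<in> carrier A" "star A h = h"
  shows "star A (((\<otimes>) h ^^ k) h) = ((\<otimes>) h ^^ k) h"
proof (induction k)
  case (Suc k)
  have "((\<otimes>) h ^^ k) h \<otimes> h = ((\<otimes>) h ^^ Suc k) h" using power_add_Suc[of h k 0] assms by simp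
  with Suc assms show ?case by (simp add: star_mult)
qed (use assms in simp)

lemma cnorm_dyadic_power:
  assumes "h \<in> carrier A" "star A h = h"
  shows "cnorm A (((\<otimes>) h ^^ (2 ^ n - 1)) h) = cnorm A h ^ (2 ^ n)"
proof (induction n)
  case (Suc n)
  let ?p = "((\<otimes>) h ^^ (2 ^ n - 1)) h"
  \<comment> \<open>The exponents are shifted by one: a product of two elements with
    \<open>2 ^ n - 1\<close> iterations each has \<open>Suc\<close> of twice that many
    iterations.\<close>
  have "(2::nat) ^ Suc n - 1 = Suc ((2 ^ n - 1) + (2 ^ n - 1))" 
    using one_le_power[of "2::nat" n] by (simp only: power_Suc) arith
  then have "((\<otimes>) h ^^ (2 ^ Suc n - 1)) h = star A ?p \<otimes> ?p"
    unfolding star_power[OF assms] power_add_Suc[OF assms(1)] by (rule arg_cong)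
  then have "cnorm A (((\<otimes>) h ^^ (2 ^ Suc n - 1)) h) = (cnorm A ?p)\<^sup>2"
    using assms by (simp add: cnorm_star_mult)
  with Suc show ?case by (simp add: power_mult[symmetric] mult.commute)
qed (use assms in simp)

lemma cnorm_funpow_mult:
  assumes "h \<in> carrier A" "x \<in> carrier A"
  shows "cnorm A (((\<otimes>) h ^^ k) x) \<le> cnorm A h ^ k * cnorm A x"
proof (induction k)
  case (Suc k)
  have "cnorm A (((\<otimes>) h ^^ Suc k) x) \<le> cnorm A h * cnorm A (((\<otimes>) h ^^ k) x)"
    using assms cnorm_mult[of h] by simp
  also have "\<dots> \<le> cnorm A h * (cnorm A h ^ k * cnorm A x)"
    using Suc assms cnorm_nonneg by (intro mult_left_mono) auto
  finally show ?case by (simp add: mult.assoc)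
qed simp

end

section \<open>The trace of the left regular representation\<close>

text \<open>A linear isomorphism onto a space of complex vectors makes matrix theory available for
  left multiplications. Every finite-dimensional algebra has one, by
  \<open>finite_dim_coordinatized\<close>; \<open>N = 0\<close> is the zero algebra.\<close>

locale coordinatized_cstar_algebra = cstar_algebra A
  for A :: "('a, 'm) normed_star_alg_scheme" (structure) +
  fixes N :: nat and co :: "'a \<Rightarrow> complex vec"
  assumes co_bij: "bij_betw co (carrier A) (carrier_vec N)"
    and co_add: "\<lbrakk>x \<in> carrier A; y \<in> carrier A\<rbrakk> \<Longrightarrow> co (x \<oplus> y) = co x + co y"
    and co_scale: "x \<in> carrier A \<Longrightarrow> co (c \<odot> x) = c \<cdot>\<^sub>v co x"
begin

definition oc :: "complex vec \<Rightarrow> 'a" where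
  "oc = inv_into (carrier A) co"

lemma co_closed [simp, intro]: "x \<in> carrier A \<Longrightarrow> co x \<in> carrier_vec N"
  using co_bij by (auto simp: bij_betw_def)

lemma dim_co [simp]: "x \<in> carrier A \<Longrightarrow> dim_vec (co x) = N"
  using co_closed by (blast dest: carrier_vecD)

lemma oc_closed [simp, intro]: "v \<in> carrier_vec N \<Longrightarrow> oc v \<in> carrier A"
  unfolding oc_def using co_bij by (metis bij_betw_def inv_into_into)

lemma co_oc [simp]: "v \<in> carrier_vec N \<Longrightarrow> co (oc v) = v"
  unfolding oc_def using co_bij by (metis bij_betw_inv_into_right)

lemma oc_co [simp]: "x \<in> carrier A \<Longrightarrow> oc (co x) = x"
  unfolding oc_def using co_bij by (metis bij_betw_inv_into_left)

lemma oc_add: "v \<in> carrier_vec N \<Longrightarrow> w \<in> carrier_vec N \<Longrightarrow> oc (v + w) = oc v \<oplus> oc w"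
  using oc_co[of "oc v \<oplus> oc w"] by (simp add: co_add)

lemma oc_scale: "v \<in> carrier_vec N \<Longrightarrow> oc (c \<cdot>\<^sub>v v) = c \<odot> oc v"
  using oc_co[of "c \<odot> oc v"] by (simp add: co_scale)

lemma co_zero: "co \<zero> = 0\<^sub>v N"
proof -
  have "co \<zero> = 0 \<cdot>\<^sub>v co \<zero>" using co_scale[of \<zero> 0] by simp
  also have "\<dots> = 0\<^sub>v N" by (intro eq_vecI) auto
  finally show ?thesis .
qed

lemma co_eq_zero_iff: "x \<in> carrier A \<Longrightarrow> co x = 0\<^sub>v N \<longleftrightarrow> x = \<zero>"
  using oc_co[of x] oc_co[of \<zero>] by (metis co_zero zero_closed)

definition lmat :: "'a \<Rightarrow> complex mat" where
  "lmat a = mat N N (\<lambda>(i, j). co (a \<otimes> oc (unit_vec N j)) $ i)"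

lemma lmat_closed [simp, intro]: "lmat a \<in> carrier_mat N N"
  by (simp add: lmat_def)

lemma dim_lmat [simp]: "dim_row (lmat a) = N" "dim_col (lmat a) = N"
  by (simp_all add: lmat_def)

lemma lmat_mult_vec:
  assumes "a \<in> carrier A" "x \<in> carrier A"
  shows "lmat a *\<^sub>v co x = co (a \<otimes> x)"
proof -
  have "co (a \<otimes> oc (co x)) = lmat a *\<^sub>v co x"
    unfolding lmat_def using assms
    by (intro linear_vec_eq_mult_mat_vec)
      (auto simp: oc_add oc_scale mult_r_distr smult_mult_r co_add co_scale)
  then show ?thesis using assms by simp
qed

lemma lmat_add:
  assumes "a \<in> carrier A" "b \<in> carrier A"
  shows "lmat (a \<oplus> b) = lmat a + lmat b"
  unfolding lmat_def using assms by (intro eq_matI) (auto simp: mult_l_distr co_add)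

lemma lmat_scale: "a \<in> carrier A \<Longrightarrow> lmat (c \<odot> a) = c \<cdot>\<^sub>m lmat a"
  unfolding lmat_def by (intro eq_matI) (auto simp: smult_mult_l co_scale)

lemma lmat_mult:
  assumes "a \<in> carrier A" "b \<in> carrier A"
  shows "lmat (a \<otimes> b) = lmat a * lmat b"
proof (rule eq_matI)
  fix i j assume ij: "i < dim_row (lmat a * lmat b)" "j < dim_col (lmat a * lmat b)"
  let ?e = "oc (unit_vec N j)"
  have "lmat (a \<otimes> b) $$ (i, j) = (lmat a *\<^sub>v (co (b \<otimes> ?e))) $ i"
    using ij assms by (simp add: lmat_mult_vec) (simp add: lmat_def mult_assoc)
  also have "co (b \<otimes> ?e) = col (lmat b) j"
    using ij assms by (intro eq_vecI) (auto simp: lmat_def)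
  finally show "lmat (a \<otimes> b) $$ (i, j) = (lmat a * lmat b) $$ (i, j)" using ij by simp
qed simp_all

lemma lmat_funpow:
  assumes "a \<in> carrier A" "x \<in> carrier A"
  shows "co (((\<otimes>) a ^^ k) x) = (lmat a ^\<^sub>m k) *\<^sub>v co x"
  using assms(2)
proof (induction k arbitrary: x)
  case 0
  then show ?case by simp
next
  case (Suc k)
  have "co (((\<otimes>) a ^^ Suc k) x) = co (((\<otimes>) a ^^ k) (a \<otimes> x))"
    by (simp only: funpow_Suc_right comp_def)
  also have "\<dots> = (lmat a ^\<^sub>m k) *\<^sub>v (lmat a *\<^sub>v co x)"
    using Suc assms(1) by (simp add: lmat_mult_vec)
  also have "\<dots> = (lmat a ^\<^sub>m Suc k) *\<^sub>v co x"
    using Suc by (simp add: assoc_mult_mat_vec[of _ N N _ N])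
  finally show ?case .
qed

text \<open>Eigenvectors are pulled back into the algebra, where star and norm can act on
  them.\<close>

lemma eigenvalue_lmat:
  assumes a: "a \<in> carrier A" and "eigenvalue (lmat a) k"
  obtains x where "x \<in> carrier A" "x \<noteq> \<zero>" "a \<otimes> x = k \<odot> x"
proof -
  obtain v where v: "v \<in> carrier_vec N" "v \<noteq> 0\<^sub>v N" "lmat a *\<^sub>v v = k \<cdot>\<^sub>v v"
    using assms unfolding eigenvalue_def eigenvector_def by auto
  have "co (a \<otimes> oc v) = co (k \<odot> oc v)"
    using v a lmat_mult_vec[of a "oc v"] by (simp add: co_scale)
  then have "a \<otimes> oc v = k \<odot> oc v"
    using v a by (metis oc_closed mult_closed scale_closed oc_co)
  moreover have "oc v \<noteq> \<zero>" using v co_oc[of v] by (metis co_zero)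
  ultimately show ?thesis using that v by blast
qed

lemma lmat_eigenvalueI:
  assumes "a \<in> carrier A" "x \<in> carrier A" "x \<noteq> \<zero>" "a \<otimes> x = k \<odot> x"
  shows "eigenvalue (lmat a) k"
  unfolding eigenvalue_def eigenvector_def using assms co_eq_zero_iff[of x]
  by (intro exI[of _ "co x"]) (auto simp: lmat_mult_vec co_scale)

lemma cmod_eigenvalue_le:
  assumes "a \<in> carrier A" "eigenvalue (lmat a) k"
  shows "cmod k \<le> cnorm A a"
proof -
  obtain x where x: "x \<in> carrier A" "x \<noteq> \<zero>" "a \<otimes> x = k \<odot> x"
    using eigenvalue_lmat[OF assms] .
  then have "cmod k * cnorm A x \<le> cnorm A a * cnorm A x"
    using cnorm_mult[of a x] assms by (simp add: cnorm_smult)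
  then show ?thesis using cnorm_pos[of x] x by simp
qed

text \<open>An eigenvector is an algebra element \<open>x\<close>, so
  \<open>star A x \<otimes> x\<close> replaces the squared length of Hilbert space theory: both
  \<open>k\<close> and \<open>cnj k\<close> scale this nonzero element to the selfadjoint
  \<open>star A x \<otimes> (h \<otimes> x)\<close>.\<close>

lemma eigenvalue_selfadjoint_real:
  assumes h: "h \<in> carrier A" "star A h = h" and "eigenvalue (lmat h) k"
  shows "k \<in> \<real>"
proof -
  obtain x where x: "x \<in> carrier A" "x \<noteq> \<zero>" "h \<otimes> x = k \<odot> x"
    using eigenvalue_lmat[OF h(1) assms(3)] .
  have "star A (star A x \<otimes> (h \<otimes> x)) = star A x \<otimes> (h \<otimes> x)"
    using x(1) h by (simp add: star_mult mult_assoc del: x(3))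
  then have "cnj k \<odot> (star A x \<otimes> x) = k \<odot> (star A x \<otimes> x)"
    using x by (simp add: smult_mult_r star_smult star_mult)
  then have "cnj k = k"
    using x star_mult_self_eq_zero[of x] by (intro scale_cancel_right[of "star A x \<otimes> x"]) auto
  then show ?thesis by (simp add: Reals_cnj_iff)
qed

section \<open>Norm and spectrum of selfadjoint elements\<close>

text \<open>The half of norm equivalence that turns bounds on matrix entries into bounds on
  \<open>cnorm\<close>. The constant is the sum of the norms of the basis elements; the triangle
  inequality is applied along truncated coordinate vectors.\<close>

lemma cnorm_le_coordinates:
  obtains K where "0 \<le> K" "\<And>x. x \<in> carrier A \<Longrightarrow> cnorm A x \<le> K * (\<Sum>i<N. cmod (co x $ i))"
proof
  let ?e = "\<lambda>i. oc (unit_vec N i)"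
  let ?K = "\<Sum>i<N. cnorm A (?e i)"
  show K: "0 \<le> ?K" using cnorm_nonneg by (intro sum_nonneg) auto
  fix x assume x: "x \<in> carrier A"
  define tr where "tr l = vec N (\<lambda>i. if i < l then co x $ i else 0)" for l
  have tr_carrier [simp]: "tr l \<in> carrier_vec N" for l by (simp add: tr_def)
  have "l \<le> N \<Longrightarrow> cnorm A (oc (tr l)) \<le> ?K * (\<Sum>i<l. cmod (co x $ i))" for l
  proof (induction l)
    case 0
    have "tr 0 = 0\<^sub>v N" by (intro eq_vecI) (auto simp: tr_def)
    then have "oc (tr 0) = \<zero>" using oc_co[of \<zero>] by (simp add: co_zero)
    then show ?case by simp
  next
    case (Suc l)
    have dec: "tr (Suc l) = tr l + co x $ l \<cdot>\<^sub>v unit_vec N l"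
      by (intro eq_vecI) (use Suc(2) in \<open>auto simp: tr_def less_Suc_eq\<close>)
    have "cnorm A (?e l) \<le> ?K"
      using Suc(2) cnorm_nonneg by (intro member_le_sum) auto
    then have "cnorm A (co x $ l \<odot> ?e l) \<le> ?K * cmod (co x $ l)"
      by (simp add: cnorm_smult mult.commute[of ?K] mult_left_mono)
    moreover have "cnorm A (oc (tr (Suc l))) \<le> cnorm A (oc (tr l)) + cnorm A (co x $ l \<odot> ?e l)"
      unfolding dec by (simp add: oc_add oc_scale cnorm_triangle)
    ultimately show ?case using Suc by (simp add: distrib_left)
  qed
  from this[of N] have "cnorm A (oc (tr N)) \<le> ?K * (\<Sum>i<N. cmod (co x $ i))" by simp
  moreover have "tr N = co x" using x by (intro eq_vecI) (auto simp: tr_def)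
  ultimately show "cnorm A x \<le> ?K * (\<Sum>i<N. cmod (co x $ i))" using x by simp
qed

text \<open>Bounded powers of \<open>lmat h\<close> bound the norms of all powers of
  \<open>h\<close> by one constant. These norms include all \<open>cnorm A h ^ 2 ^ n\<close>, which
  would be unbounded if \<open>cnorm A h\<close> exceeded 1.\<close>

lemma cnorm_le_one_if_eigenvalues_less_one:
  assumes h: "h \<in> carrier A" "star A h = h"
    and ev: "\<And>k. eigenvalue (lmat h) k \<Longrightarrow> cmod k < 1"
  shows "cnorm A h \<le> 1"
proof (cases "N = 0")
  \<comment> \<open>In dimension zero the spectrum is empty and \<open>mat_power_bounded\<close>
    does not apply, but then \<open>h\<close> is zero.\<close>
  case True
  then have "co h = 0\<^sub>v N" using h co_closed[of h] by (intro eq_vecI) auto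
  then show ?thesis using co_eq_zero_iff[of h] h by simp
next
  case False
  then obtain c where c: "\<And>k i j. i < N \<Longrightarrow> j < N \<Longrightarrow> cmod ((lmat h ^\<^sub>m k) $$ (i, j)) \<le> c"
    using mat_power_bounded[OF lmat_closed _ ev] by blast
  obtain K where K: "0 \<le> K" "\<And>x. x \<in> carrier A \<Longrightarrow> cnorm A x \<le> K * (\<Sum>i<N. cmod (co x $ i))"
    using cnorm_le_coordinates by blast
  \<comment> \<open>\<open>c\<close> bounds the entries of all powers of \<open>lmat h\<close>, so
    the inner sum bounds each coordinate of a power of \<open>h\<close>; \<open>K\<close> passes
    from coordinates to the norm.\<close>
  define C where "C = K * (\<Sum>i<N. \<Sum>j<N. c * cmod (co h $ j))"
  have bound: "cnorm A (((\<otimes>) h ^^ k) h) \<le> C" for k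
  proof -
    have "cmod (co (((\<otimes>) h ^^ k) h) $ i) \<le> (\<Sum>j<N. c * cmod (co h $ j))" if i: "i < N" for i
    proof -
      have M: "lmat h ^\<^sub>m k \<in> carrier_mat N N" by (simp add: pow_carrier_mat)
      have "co (((\<otimes>) h ^^ k) h) $ i = (\<Sum>j<N. (lmat h ^\<^sub>m k) $$ (i, j) * co h $ j)"
        unfolding lmat_funpow[OF h(1) h(1)] using M i h
        by (auto simp: scalar_prod_def lessThan_atLeast0 intro!: sum.cong)
      also have "cmod \<dots> \<le> (\<Sum>j<N. cmod ((lmat h ^\<^sub>m k) $$ (i, j) * co h $ j))" by (rule norm_sum)
      also have "\<dots> \<le> (\<Sum>j<N. c * cmod (co h $ j))"
        using c i by (intro sum_mono) (auto simp: norm_mult mult_right_mono)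
      finally show ?thesis .
    qed
    then have "(\<Sum>i<N. cmod (co (((\<otimes>) h ^^ k) h) $ i)) \<le> (\<Sum>i<N. \<Sum>j<N. c * cmod (co h $ j))"
      by (intro sum_mono) auto
    then show ?thesis
      using K(2)[of "((\<otimes>) h ^^ k) h"] K(1) h unfolding C_def
      by (meson funpow_mult_closed mult_left_mono order_trans)
  qed
  show ?thesis
  proof (rule le_if_dyadic_powers_le[where C = C])
    show "cnorm A h ^ 2 ^ n \<le> C * 1 ^ 2 ^ n" for n
      using bound[of "2 ^ n - 1"] by (simp only: cnorm_dyadic_power[OF h] power_one mult_1_right)
  qed simp
qed

lemma cnorm_le_if_eigenvalues_le:
  assumes h: "h \<in> carrier A" "star A h = h"
    and "0 \<le> t" and ev: "\<And>k. eigenvalue (lmat h) k \<Longrightarrow> cmod k \<le> t"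
  shows "cnorm A h \<le> t"
proof (rule field_le_epsilon)
  fix e :: real assume "0 < e"
  \<comment> \<open>Dividing by \<open>t + e\<close> instead of \<open>t\<close> makes the
    eigenvalue bound strict and also allows \<open>t = 0\<close>.\<close>
  define s where "s = t + e"
  have s: "0 < s" "t < s" using \<open>0 < e\<close> \<open>0 \<le> t\<close> by (auto simp: s_def)
  let ?g = "of_real (1 / s) \<odot> h"
  have "cnorm A ?g \<le> 1"
  proof (rule cnorm_le_one_if_eigenvalues_less_one)
    fix k assume "eigenvalue (lmat ?g) k"
    then obtain x where x: "x \<in> carrier A" "x \<noteq> \<zero>" "?g \<otimes> x = k \<odot> x"
      using eigenvalue_lmat[of ?g k] h by blast
    have "h \<otimes> x = of_real s \<odot> (?g \<otimes> x)"
      using x(1) h s by (simp add: smult_mult_l scale_scale)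
    also have "\<dots> = (of_real s * k) \<odot> x" using x by (simp add: scale_scale)
    finally have "cmod (of_real s * k) \<le> t" using x h by (intro ev lmat_eigenvalueI) auto
    then have "s * cmod k \<le> t" using s by (simp add: norm_mult)
    with s have "s * cmod k < s * 1" by linarith
    then show "cmod k < 1" using s by (simp only: mult_less_cancel_left_pos)
  qed (use h in \<open>auto simp: star_smult\<close>)
  then show "cnorm A h \<le> t + e" using h s by (simp add: cnorm_smult s_def[symmetric] norm_divide)
qed

section \<open>The trace as a faithful positive functional\<close>

text \<open>On a full algebra of \<open>r\<close> by \<open>r\<close> matrices this is
  \<open>r\<close> times the usual trace.\<close>

definition tau :: "'a \<Rightarrow> complex" where
  "tau a = mat_trace (lmat a)"

lemma tau_add: "a \<in> carrier A \<Longrightarrow> b \<in> carrier A \<Longrightarrow> tau (a \<oplus> b) = tau a + tau b"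
  by (simp add: tau_def lmat_add mat_trace_def sum.distrib)

lemma tau_scale: "a \<in> carrier A \<Longrightarrow> tau (c \<odot> a) = c * tau a"
  by (simp add: tau_def lmat_scale mat_trace_def sum_distrib_left)

lemma tau_zero [simp]: "tau \<zero> = 0"
  using tau_scale[of \<zero> 0] by simp

lemma tau_mult_commute: "a \<in> carrier A \<Longrightarrow> b \<in> carrier A \<Longrightarrow> tau (a \<otimes> b) = tau (b \<otimes> a)"
  by (simp add: tau_def lmat_mult mat_trace_mult_commute[of _ N])

lemma cmod_tau_le:
  assumes "a \<in> carrier A"
  shows "cmod (tau a) \<le> N * cnorm A a"
proof -
  obtain f where f: "{f i |i. i < N} = Collect (eigenvalue (lmat a))" "mat_trace (lmat a) = (\<Sum>i<N. f i)"
    using mat_trace_eigenvalues[OF lmat_closed[of a]] .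
  have "cmod (tau a) \<le> (\<Sum>i<N. cmod (f i))" unfolding tau_def f(2) by (rule norm_sum)
  also have "\<dots> \<le> (\<Sum>i<N. cnorm A a)"
    using f(1) assms by (intro sum_mono cmod_eigenvalue_le) auto
  finally show ?thesis by simp
qed

text \<open>The trace of the square is the sum of the squared eigenvalues, which are real. If it
  vanishes, so do all eigenvalues, and the spectral bound with \<open>t = 0\<close> gives the second
  claim.\<close>

lemma tau_selfadjoint_square:
  assumes h: "h \<in> carrier A" "star A h = h"
  shows "0 \<le> Re (tau (h \<otimes> h))" and "Re (tau (h \<otimes> h)) = 0 \<Longrightarrow> h = \<zero>"
proof -
  obtain f where f: "{f i |i. i < N} = Collect (eigenvalue (lmat h))"
    "mat_trace (lmat h * lmat h) = (\<Sum>i<N. (f i)\<^sup>2)"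
    using mat_trace_eigenvalues[OF lmat_closed[of h]] .
  have "f i \<in> \<real>" if "i < N" for i
    using f(1) that by (intro eigenvalue_selfadjoint_real[OF h]) auto
  then have im: "Im (f i) = 0" if "i < N" for i
    using that by (auto simp: complex_is_Real_iff)
  then have eq: "Re (tau (h \<otimes> h)) = (\<Sum>i<N. (Re (f i))\<^sup>2)"
    using h by (simp add: tau_def lmat_mult f(2))
  then show "0 \<le> Re (tau (h \<otimes> h))" by (simp add: sum_nonneg)
  assume "Re (tau (h \<otimes> h)) = 0"
  then have "\<forall>i<N. Re (f i) = 0" using eq by (simp add: sum_nonneg_eq_0_iff)
  with im have zero: "\<forall>i<N. f i = 0" by (simp add: complex_eq_iff)
  have "k = 0" if "eigenvalue (lmat h) k" for k
  proof -
    have "k \<in> {f i |i. i < N}" using f(1) that by simp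
    then show ?thesis using zero by auto
  qed
  then have "cnorm A h \<le> 0" by (intro cnorm_le_if_eigenvalues_le[OF h]) auto
  then show "h = \<zero>" using cnorm_pos[of h] h by fastforce
qed

text \<open>Write \<open>u = a + i b\<close> with selfadjoint \<open>a\<close> and \<open>b\<close>.
  Then \<open>a a + b b\<close> is the average of \<open>u^* u\<close> and \<open>u u^*\<close>,
  which have the same trace, so both claims reduce to selfadjoint squares.\<close>

lemma tau_star_mult_self:
  assumes u: "u \<in> carrier A"
  shows "0 \<le> Re (tau (star A u \<otimes> u))" and "Re (tau (star A u \<otimes> u)) = 0 \<Longrightarrow> u = \<zero>"
proof -
  let ?a = "(1 / 2) \<odot> (u \<oplus> star A u)" and ?b = "(\<i> / 2) \<odot> (star A u \<oplus> (- 1) \<odot> u)"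
  have a: "?a \<in> carrier A" "star A ?a = ?a"
    using u by (auto simp: star_smult star_add a_comm)
  have b: "?b \<in> carrier A" "star A ?b = ?b"
    using u by (auto simp: star_smult star_add a_comm scale_add_right scale_scale)
  have "tau (?a \<otimes> ?a) + tau (?b \<otimes> ?b) = (tau (star A u \<otimes> u) + tau (u \<otimes> star A u)) / 2"
    using u by (simp add: tau_add tau_scale mult_l_distr mult_r_distr smult_mult_l smult_mult_r field_simps)
  also have "\<dots> = tau (star A u \<otimes> u)" using u tau_mult_commute[of "star A u" u] by simp
  finally have eq: "Re (tau (star A u \<otimes> u)) = Re (tau (?a \<otimes> ?a)) + Re (tau (?b \<otimes> ?b))"
    by (metis plus_complex.sel(1))
  then show "0 \<le> Re (tau (star A u \<otimes> u))"
    using tau_selfadjoint_square(1)[OF a] tau_selfadjoint_square(1)[OF b] by simp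
  assume "Re (tau (star A u \<otimes> u)) = 0"
  then have zero: "?a = \<zero>" "?b = \<zero>"
    using eq tau_selfadjoint_square[OF a] tau_selfadjoint_square[OF b] by simp_all
  have "?a \<oplus> \<i> \<odot> ?b = ((1 / 2) \<odot> u \<oplus> (1 / 2) \<odot> u) \<oplus> ((1 / 2) \<odot> star A u \<oplus> (- (1 / 2)) \<odot> star A u)"
    using u by (simp add: scale_add_right scale_scale a_ac)
  also have "\<dots> = u" using u by (simp add: scale_add_left[symmetric])
  finally show "u = \<zero>" using zero by simp
qed

end

section \<open>Nondegeneracy of the trace and existence of the unit\<close>

context coordinatized_cstar_algebra
begin

lemma linear_functional_coordinates:
  assumes add: "\<And>x y. x \<in> carrier A \<Longrightarrow> y \<in> carrier A \<Longrightarrow> L (x \<oplus> y) = L x + L y"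
    and scale: "\<And>c x. x \<in> carrier A \<Longrightarrow> L (c \<odot> x) = c * L x"
    and x: "x \<in> carrier A"
  shows "L x = (\<Sum>j<N. L (oc (unit_vec N j)) * co x $ j)"
proof -
  \<comment> \<open>The functional becomes a map into vectors of length 1, so that the matrix
    representation of linear maps applies.\<close>
  let ?F = "\<lambda>v. vec 1 (\<lambda>_. L (oc v))"
  have "?F (co x) = mat 1 N (\<lambda>(i, j). ?F (unit_vec N j) $ i) *\<^sub>v co x"
    using x by (intro linear_vec_eq_mult_mat_vec) (auto simp: oc_add oc_scale add scale)
  then have "?F (co x) $ 0 = (mat 1 N (\<lambda>(i, j). ?F (unit_vec N j) $ i) *\<^sub>v co x) $ 0"
    by simp
  then show ?thesis using x by (simp add: scalar_prod_def lessThan_atLeast0)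
qed

text \<open>Take \<open>z\<close> to be the adjoint of \<open>a \<ominus> b\<close> and use that
  \<open>tau\<close> is faithful.\<close>

lemma tau_eqI:
  assumes "a \<in> carrier A" "b \<in> carrier A" and eq: "\<And>z. z \<in> carrier A \<Longrightarrow> tau (z \<otimes> a) = tau (z \<otimes> b)"
  shows "a = b"
proof -
  let ?d = "a \<ominus> b"
  have d: "?d \<in> carrier A" using assms by simp
  have "tau (star A ?d \<otimes> ?d) = tau (star A ?d \<otimes> a) - tau (star A ?d \<otimes> b)"
    using assms(1,2) d
    by (simp add: diff_conv_scale[of a b] mult_r_distr smult_mult_r tau_add tau_scale)
  also have "\<dots> = 0" using eq[of "star A ?d"] d by simp
  finally have "?d = \<zero>" using tau_star_mult_self(2)[OF d] by simp
  then show ?thesis using assms by simp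
qed

text \<open>A right unit is the vector representing the functional \<open>tau\<close> in the nondegenerate bilinear
  form \<open>tau (x \<otimes> y)\<close>.\<close>

lemma unit_exists:
  obtains e where "e \<in> carrier A" "\<And>x. x \<in> carrier A \<Longrightarrow> e \<otimes> x = x" "\<And>x. x \<in> carrier A \<Longrightarrow> x \<otimes> e = x"
proof -
  let ?b = "\<lambda>i. oc (unit_vec N i)"
  \<comment> \<open>The Gram matrix of the bilinear form in the chosen basis; by
    \<open>tau_eqI\<close> its kernel is trivial.\<close>
  let ?G = "mat N N (\<lambda>(i, j). tau (?b i \<otimes> ?b j))"
  have G: "(?G *\<^sub>v v) $ i = tau (?b i \<otimes> oc v)" if "v \<in> carrier_vec N" "i < N" for v i
    using that linear_functional_coordinates[of "\<lambda>y. tau (?b i \<otimes> y)" "oc v"]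
    by (simp add: scalar_prod_def lessThan_atLeast0 mult_r_distr smult_mult_r tau_add tau_scale)
  have from_basis: "tau (z \<otimes> y) = tau (z \<otimes> y')"
    if "\<And>i. i < N \<Longrightarrow> tau (?b i \<otimes> y) = tau (?b i \<otimes> y')"
      and "y \<in> carrier A" "y' \<in> carrier A" "z \<in> carrier A" for y y' z
    using that linear_functional_coordinates[of "\<lambda>z. tau (z \<otimes> y)" z]
      linear_functional_coordinates[of "\<lambda>z. tau (z \<otimes> y')" z]
    by (simp add: mult_l_distr smult_mult_l tau_add tau_scale)
  obtain v where v: "v \<in> carrier_vec N" "?G *\<^sub>v v = vec N (\<lambda>i. tau (?b i))"
  proof (rule solve_if_kernel_trivial[of ?G N "vec N (\<lambda>i. tau (?b i))"])
    fix v assume v: "v \<in> carrier_vec N" "?G *\<^sub>v v = 0\<^sub>v N"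
    have basis: "tau (?b i \<otimes> oc v) = tau (?b i \<otimes> \<zero>)" if "i < N" for i
      using G[OF v(1) that] that v by simp
    have "oc v = \<zero>"
      by (rule tau_eqI[OF oc_closed[OF v(1)] zero_closed], rule from_basis)
        (use basis v in simp_all)
    then show "v = 0\<^sub>v N" using co_oc[OF v(1)] by (simp add: co_zero)
  qed auto
  define e where "e = oc v"
  have e: "e \<in> carrier A" using v by (simp add: e_def)
  have "tau (?b i \<otimes> e) = tau (?b i)" if "i < N" for i
    using G[OF v(1) that] that v unfolding e_def by simp
  then have tau_e: "tau (y \<otimes> e) = tau y" if "y \<in> carrier A" for y
    using that e linear_functional_coordinates[of "\<lambda>z. tau (z \<otimes> e)" y]
      linear_functional_coordinates[of tau y]
    by (simp add: mult_l_distr smult_mult_l tau_add tau_scale)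
  have right: "x \<otimes> e = x" if "x \<in> carrier A" for x
    using that e tau_e by (intro tau_eqI) (auto simp: mult_assoc[symmetric])
  \<comment> \<open>The adjoint of a right unit is a left unit; evaluating
    \<open>star A e \<otimes> e\<close> in both ways then shows that \<open>e\<close> is
    selfadjoint, hence two-sided.\<close>
  have left: "star A e \<otimes> x = x" if "x \<in> carrier A" for x
    using right[of "star A x"] that e star_mult[of "star A x" e] by simp
  have "star A e = e" using left[OF e] right[of "star A e"] e by simp
  then show ?thesis using that e left right by simp
qed

lemma alg_unit:
  shows alg_unit_closed: "alg_unit A \<in> carrier A"
    and alg_unit_left: "x \<in> carrier A \<Longrightarrow> alg_unit A \<otimes> x = x"
    and alg_unit_right: "x \<in> carrier A \<Longrightarrow> x \<otimes> alg_unit A = x"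
proof -
  obtain e where e: "e \<in> carrier A" "\<And>x. x \<in> carrier A \<Longrightarrow> e \<otimes> x = x" "\<And>x. x \<in> carrier A \<Longrightarrow> x \<otimes> e = x"
    using unit_exists by blast
  have "alg_unit A = e"
    unfolding alg_unit_def
  proof (rule the_equality)
    fix u assume "u \<in> carrier A \<and> (\<forall>x\<in>carrier A. u \<otimes> x = x \<and> x \<otimes> u = x)"
    then show "u = e" using e(1) e(2)[of u] by metis
  qed (use e in auto)
  then show "alg_unit A \<in> carrier A" "x \<in> carrier A \<Longrightarrow> alg_unit A \<otimes> x = x"
    "x \<in> carrier A \<Longrightarrow> x \<otimes> alg_unit A = x"
    using e by auto
qed

lemma star_alg_unit: "star A (alg_unit A) = alg_unit A"
  using alg_unit_left[of "star A (alg_unit A)"] star_mult[of "alg_unit A" "star A (alg_unit A)"]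
    alg_unit_closed by (simp add: alg_unit_right)

section \<open>Comparison of norms through the trace\<close>

text \<open>Selfadjointness of \<open>star A x \<otimes> z\<close> makes the two cross terms equal,
  so the classical argument works with real coefficients.\<close>

lemma tau_Cauchy_Schwarz:
  assumes x: "x \<in> carrier A" and z: "z \<in> carrier A"
    and sa: "star A (star A x \<otimes> z) = star A x \<otimes> z"
  shows "(Re (tau (star A x \<otimes> z)))\<^sup>2 \<le> Re (tau (star A x \<otimes> x)) * Re (tau (star A z \<otimes> z))"
proof (cases "x = \<zero>")
  case False
  let ?p = "Re (tau (star A x \<otimes> x))" and ?q = "Re (tau (star A x \<otimes> z))"
    and ?r = "Re (tau (star A z \<otimes> z))"
  have p: "0 < ?p" using tau_star_mult_self[OF x] False by fastforce
  have zx: "star A z \<otimes> x = star A x \<otimes> z" using sa x z by (simp add: star_mult)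
  \<comment> \<open>\<open>?p\<close> times the component of \<open>z\<close> orthogonal to
    \<open>x\<close>; the scaling avoids a division.\<close>
  let ?w = "of_real ?p \<odot> z \<oplus> of_real (- ?q) \<odot> x"
  have "Re (tau (star A ?w \<otimes> ?w)) = ?p * (?p * ?r - ?q\<^sup>2)"
    using x z
    by (simp add: star_add star_smult mult_l_distr mult_r_distr smult_mult_l smult_mult_r
        tau_add tau_scale zx power2_eq_square algebra_simps)
  then have "0 \<le> ?p * (?p * ?r - ?q\<^sup>2)" using tau_star_mult_self(1)[of ?w] x z by simp
  then show ?thesis using p by (simp add: zero_le_mult_iff)
qed (use z in simp)

lemma funpow_mult_adjoint:
  assumes "b \<in> carrier A" "star A b = b" "x \<in> carrier A" "y \<in> carrier A"
  shows "star A (((\<otimes>) b ^^ k) x) \<otimes> y = star A x \<otimes> ((\<otimes>) b ^^ k) y"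
  using assms(4)
proof (induction k arbitrary: y)
  case (Suc k)
  have "((\<otimes>) b ^^ Suc k) y = ((\<otimes>) b ^^ k) (b \<otimes> y)"
    by (simp only: funpow_Suc_right comp_def)
  then show ?case
    using assms(1-3) Suc.prems Suc.IH[of "b \<otimes> y"]
    by (simp add: star_mult mult_assoc del: funpow.simps(2)) (simp add: star_mult mult_assoc)
qed simp

text \<open>Iterating Cauchy--Schwarz gives \<open>(s 1 / s 0) ^ 2 ^ n \<le> s (2 ^ n) / s 0\<close> for the moments
  \<open>s k\<close> of \<open>b\<close>, and \<open>s (2 ^ n)\<close> is \<open>O (cnorm A b ^ 2 ^ n)\<close>.\<close>

lemma tau_conjugate_le:
  assumes b: "b \<in> carrier A" "star A b = b" and x: "x \<in> carrier A"
  shows "Re (tau (star A x \<otimes> (b \<otimes> x))) \<le> cnorm A b * Re (tau (star A x \<otimes> x))"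
proof (cases "x = \<zero>")
  case False
  define s where "s k = Re (tau (star A x \<otimes> ((\<otimes>) b ^^ k) x))" for k
  have p: "0 < s 0" using tau_star_mult_self[OF x] False by (fastforce simp: s_def)
  \<comment> \<open>Cauchy-Schwarz for \<open>x\<close> and \<open>b^k x\<close>: as
    \<open>b\<close> is selfadjoint, the squared length of \<open>b^k x\<close> is the moment of
    order \<open>2 * k\<close>.\<close>
  have sq: "(s k)\<^sup>2 \<le> s 0 * s (2 * k)" for k
  proof -
    let ?z = "((\<otimes>) b ^^ k) x"
    have z: "?z \<in> carrier A" using b x by simp
    have "star A (star A x \<otimes> ?z) = star A x \<otimes> ?z"
      using b x z funpow_mult_adjoint[OF b x x, of k] by (simp add: star_mult)
    moreover have "star A ?z \<otimes> ?z = star A x \<otimes> ((\<otimes>) b ^^ (2 * k)) x"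
      using funpow_mult_adjoint[OF b x z, of k] by (simp add: mult_2 funpow_add)
    ultimately show ?thesis using tau_Cauchy_Schwarz[OF x z] by (simp add: s_def)
  qed
  have "(\<bar>s 1\<bar> / s 0) ^ 2 ^ n \<le> \<bar>s (2 ^ n)\<bar> / s 0" for n
  proof (induction n)
    case (Suc n)
    have "(\<bar>s 1\<bar> / s 0) ^ 2 ^ Suc n = ((\<bar>s 1\<bar> / s 0) ^ 2 ^ n)\<^sup>2"
      by (simp add: power_mult[symmetric] mult.commute)
    also have "\<dots> \<le> (\<bar>s (2 ^ n)\<bar> / s 0)\<^sup>2" using Suc p by (intro power_mono) auto
    also have "\<dots> \<le> s (2 * 2 ^ n) / s 0"
      using sq[of "2 ^ n"] p by (simp add: power_divide power2_eq_square field_simps)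
    also have "\<dots> \<le> \<bar>s (2 ^ Suc n)\<bar> / s 0" using p by (simp add: divide_right_mono)
    finally show ?case .
  qed simp
  moreover have "\<bar>s k\<bar> / s 0 \<le> (N * (cnorm A x)\<^sup>2 / s 0) * cnorm A b ^ k" for k
  proof -
    let ?z = "((\<otimes>) b ^^ k) x"
    have "\<bar>s k\<bar> \<le> cmod (tau (star A x \<otimes> ?z))" unfolding s_def by (rule abs_Re_le_cmod)
    also have "\<dots> \<le> N * cnorm A (star A x \<otimes> ?z)" using b x by (intro cmod_tau_le) auto
    also have "\<dots> \<le> N * (cnorm A x * (cnorm A b ^ k * cnorm A x))"
      using b x cnorm_mult[of "star A x" ?z] cnorm_funpow_mult[of b x k] cnorm_nonneg[of x]
      by (intro mult_left_mono) (auto intro: order_trans mult_left_mono)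
    finally have "\<bar>s k\<bar> \<le> N * (cnorm A x)\<^sup>2 * cnorm A b ^ k"
      by (simp add: power2_eq_square mult_ac)
    then show ?thesis using p by (simp add: divide_right_mono)
  qed
  ultimately have "(\<bar>s 1\<bar> / s 0) ^ 2 ^ n \<le> (N * (cnorm A x)\<^sup>2 / s 0) * cnorm A b ^ 2 ^ n" for n
    using order_trans by blast
  then have "\<bar>s 1\<bar> / s 0 \<le> cnorm A b"
    by (rule le_if_dyadic_powers_le[OF cnorm_nonneg[OF b(1)]])
  then have "\<bar>s 1\<bar> \<le> cnorm A b * s 0" using p by (simp add: field_simps)
  then show ?thesis by (simp add: s_def)
qed (use b in simp)

text \<open>Let \<open>x\<close> be an eigenvector of \<open>star A u \<otimes> u\<close> for
  \<open>k\<close>, and \<open>b\<close> the whole sum. The trace of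
  \<open>star A x \<otimes> (b \<otimes> x)\<close> is at least \<open>k\<close> times that of
  \<open>star A x \<otimes> x\<close>, since the \<open>v\<close> term is nonnegative, and
  \<open>tau_conjugate_le\<close> bounds it above. So every eigenvalue lies between 0 and
  \<open>cnorm A b\<close>.\<close>

lemma cnorm_le_sum_star_mult:
  assumes u: "u \<in> carrier A" and v: "v \<in> carrier A"
  shows "(cnorm A u)\<^sup>2 \<le> cnorm A (star A u \<otimes> u \<oplus> star A v \<otimes> v)"
proof -
  let ?h = "star A u \<otimes> u" and ?b = "star A u \<otimes> u \<oplus> star A v \<otimes> v"
  have h: "?h \<in> carrier A" "star A ?h = ?h" using u by (auto simp: star_mult)
  have b: "?b \<in> carrier A" "star A ?b = ?b" using u v by (auto simp: star_mult star_add)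
  have "cnorm A ?h \<le> cnorm A ?b"
  proof (rule cnorm_le_if_eigenvalues_le[OF h])
    fix k assume ev: "eigenvalue (lmat ?h) k"
    obtain x where x: "x \<in> carrier A" "x \<noteq> \<zero>" "?h \<otimes> x = k \<odot> x"
      using eigenvalue_lmat[OF h(1) ev] .
    have k: "k = of_real (Re k)" using eigenvalue_selfadjoint_real[OF h ev] by simp
    let ?p = "Re (tau (star A x \<otimes> x))" and ?t = "\<lambda>u. Re (tau (star A (u \<otimes> x) \<otimes> (u \<otimes> x)))"
    have p: "0 < ?p" using tau_star_mult_self[OF x(1)] x(2) by fastforce
    have "star A x \<otimes> (?h \<otimes> x) = star A (u \<otimes> x) \<otimes> (u \<otimes> x)"
      using u x(1) by (simp add: star_mult mult_assoc)
    then have "star A (u \<otimes> x) \<otimes> (u \<otimes> x) = k \<odot> (star A x \<otimes> x)"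
      using x by (simp add: smult_mult_r)
    then have "tau (star A (u \<otimes> x) \<otimes> (u \<otimes> x)) = k * tau (star A x \<otimes> x)"
      using x(1) by (simp add: tau_scale)
    then have tu: "?t u = Re k * ?p" by (subst (asm) k) simp
    have "star A x \<otimes> (?b \<otimes> x) = star A (u \<otimes> x) \<otimes> (u \<otimes> x) \<oplus> star A (v \<otimes> x) \<otimes> (v \<otimes> x)"
      using u v x(1) by (simp add: star_mult mult_assoc mult_l_distr mult_r_distr)
    then have "?t u + ?t v \<le> cnorm A ?b * ?p"
      using tau_conjugate_le[OF b x(1)] u v x(1) by (simp add: tau_add)
    moreover have "0 \<le> ?t u" "0 \<le> ?t v" using u v x(1) by (auto intro: tau_star_mult_self(1))
    ultimately have "0 \<le> Re k * ?p" "Re k * ?p \<le> cnorm A ?b * ?p" using tu by linarith+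
    then have "0 \<le> Re k" "Re k \<le> cnorm A ?b" using p by (simp_all add: zero_le_mult_iff)
    then show "cmod k \<le> cnorm A ?b" by (subst k) simp
  qed (use b cnorm_nonneg in simp)
  then show ?thesis using u by (simp add: cnorm_star_mult)
qed

end

section \<open>Coordinates on a finite-dimensional C*-algebra\<close>

text \<open>The finite spanning set provides a finite basis \<open>S\<close>. Numbering it by
  \<open>g\<close> turns linear combinations into the bijection \<open>lin\<close>, and
  \<open>co\<close> is its inverse.\<close>

lemma finite_dim_coordinatized:
  fixes A :: "('a, 'm) normed_star_alg_scheme" (structure)
  assumes "cstar_algebra A" and "finite_dim A"
  obtains N co where "coordinatized_cstar_algebra A N co"
proof -
  interpret cstar_algebra A by fact
  interpret V: vectorspace complex_ring A
    unfolding vectorspace_def using module_axioms field_from_type_algebra by blast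
  obtain B where B: "finite B" "B \<subseteq> carrier A"
    "\<And>x. x \<in> carrier A \<Longrightarrow> \<exists>c. x = (\<Oplus>b\<in>B. c b \<odot> b)"
    using assms(2) unfolding finite_dim_def by blast
  have "carrier A \<subseteq> span B"
    using B unfolding span_def lincomb_def by auto
  then have "span B = carrier A" using span_is_subset2[OF B(2)] by blast
  then have "V.fin_dim" unfolding V.fin_dim_def using B by blast
  then obtain S where S: "finite S" "V.basis S" using V.finite_basis_exists by blast
  then have SA: "S \<subseteq> carrier A" by (simp add: V.basis_def)
  have ex1: "\<exists>!a. a \<in> S \<rightarrow>\<^sub>E UNIV \<and> lincomb a S = x" if "x \<in> carrier A" for x
    using V.basis_criterion[OF S(1) SA] S(2) that by simp
  define N where "N = card S"
  obtain g where g: "bij_betw g S {..<N}"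
    using ex_bij_betw_finite_nat[OF S(1)] by (auto simp: N_def lessThan_atLeast0)
  define lin where "lin v = (\<Oplus>b\<in>S. (v $ g b) \<odot> b)" for v :: "complex vec"
  have gN: "g b < N" if "b \<in> S" for b using g that by (auto simp: bij_betw_def)
  have lin_closed: "lin v \<in> carrier A" for v
    unfolding lin_def using SA by (intro finsum_closed) auto
  have lin_add: "lin (v + w) = lin v \<oplus> lin w" if "v \<in> carrier_vec N" "w \<in> carrier_vec N" for v w
  proof -
    have "lin (v + w) = (\<Oplus>b\<in>S. (v $ g b) \<odot> b \<oplus> (w $ g b) \<odot> b)"
      unfolding lin_def using SA that gN
      by (intro finsum_cong) (auto simp: simp_implies_def scale_add_left subset_iff)
    also have "\<dots> = lin v \<oplus> lin w"
      unfolding lin_def using SA by (intro finsum_addf) auto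
    finally show ?thesis .
  qed
  have lin_scale: "lin (c \<cdot>\<^sub>v v) = c \<odot> lin v" if "v \<in> carrier_vec N" for c v
  proof -
    have "lin (c \<cdot>\<^sub>v v) = (\<Oplus>b\<in>S. c \<odot> ((v $ g b) \<odot> b))"
      unfolding lin_def using SA that gN
      by (intro finsum_cong) (auto simp: simp_implies_def scale_scale subset_iff)
    also have "\<dots> = c \<odot> lin v"
      unfolding lin_def using SA S by (intro finsum_smult[symmetric]) auto
    finally show ?thesis .
  qed
  have lin_bij: "bij_betw lin (carrier_vec N) (carrier A)"
    unfolding bij_betw_def
  proof
    \<comment> \<open>Coefficients are unique only among functions extensional on \<open>S\<close>,
      hence \<open>restrict\<close>.\<close>
    have lin_lincomb: "lin v = lincomb (restrict (\<lambda>b. v $ g b) S) S" for v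
      unfolding lin_def lincomb_def using SA
      by (intro finsum_cong) (auto simp: simp_implies_def subset_iff)
    show "inj_on lin (carrier_vec N)"
    proof (rule inj_onI)
      fix v w assume vw: "v \<in> carrier_vec N" "w \<in> carrier_vec N" "lin v = lin w"
      let ?r = "\<lambda>v :: complex vec. restrict (\<lambda>b. v $ g b) S"
      have "?r v = ?r w"
        using ex1[OF lin_closed[of v]] lin_lincomb[of v] lin_lincomb[of w] vw(3)
        by (metis (no_types, lifting) PiE_UNIV_domain UNIV_I restrict_PiE_iff)
      then have eq: "v $ g b = w $ g b" if "b \<in> S" for b using that by (metis restrict_apply')
      have "v $ i = w $ i" if i: "i < N" for i
      proof -
        have "i \<in> g ` S" using i g by (simp add: bij_betw_def)
        then show ?thesis using eq by blast
      qed
      then show "v = w" using vw by (intro eq_vecI) auto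
    qed
    show "lin ` carrier_vec N = carrier A"
    proof
      show "carrier A \<subseteq> lin ` carrier_vec N"
      proof
        fix x assume "x \<in> carrier A"
        then obtain a where a: "lincomb a S = x" using ex1 by blast
        let ?v = "vec N (\<lambda>i. a (inv_into S g i))"
        have "lin ?v = lincomb a S"
          unfolding lin_def lincomb_def using SA gN g
          by (intro finsum_cong) (auto simp: simp_implies_def subset_iff bij_betw_inv_into_left)
        then show "x \<in> lin ` carrier_vec N" using a by (intro image_eqI[of _ _ ?v]) auto
      qed
    qed (use lin_closed in auto)
  qed
  define co where "co = inv_into (carrier_vec N) lin"
  have co: "co x \<in> carrier_vec N" "lin (co x) = x" if "x \<in> carrier A" for x
    using lin_bij that unfolding co_def by (auto simp: bij_betw_def intro: inv_into_into f_inv_into_f)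
  have co_lin: "co (lin v) = v" if "v \<in> carrier_vec N" for v
    using lin_bij that unfolding co_def by (rule bij_betw_inv_into_left)
  have "coordinatized_cstar_algebra A N co"
  proof
    show "bij_betw co (carrier A) (carrier_vec N)"
      unfolding co_def by (rule bij_betw_inv_into[OF lin_bij])
    show "co (x \<oplus> y) = co x + co y" if "x \<in> carrier A" "y \<in> carrier A" for x y
      using co_lin[of "co x + co y"] co that by (simp add: lin_add)
    show "co (c \<odot> x) = c \<cdot>\<^sub>v co x" if "x \<in> carrier A" for c x
      using co_lin[of "c \<cdot>\<^sub>v co x"] co that by (simp add: lin_scale)
  qed
  then show ?thesis by (rule that)
qed

section \<open>Completely positive contractions\<close>

lemma (in cstar_algebra) mat_alg_2_star_mult:
  assumes "c \<in> carrier (mat_alg 2 A)" "i < 2" "j < 2"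
  shows "(star (mat_alg 2 A) c \<otimes>\<^bsub>mat_alg 2 A\<^esub> c) i j =
    star A (c 0 i) \<otimes> c 0 j \<oplus> star A (c 1 i) \<otimes> c 1 j"
proof -
  have "c i' j' \<in> carrier A" if "i' < 2" "j' < 2" for i' j'
    using assms(1) that by (auto simp: mat_alg_def split: if_splits)
  with assms(2,3) show ?thesis
    by (simp add: mat_alg_def numeral_2_eq_2 lessThan_Suc a_comm)
qed

text \<open>\<open>p, q, r, s\<close> are the entries of a matrix \<open>b\<close> for which \<open>b\<^sup>*b\<close> is the image of
  the positive matrix with rows \<open>(1, f)\<close> and \<open>(f\<^sup>*, f\<^sup>*f)\<close>.\<close>

lemma completely_positive_unit_column:
  fixes A :: "('a, 'm) normed_star_alg_scheme" and B :: "('b, 'n) normed_star_alg_scheme" (structure)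
  assumes A: "coordinatized_cstar_algebra A N co" and B: "cstar_algebra B"
    and \<phi>: "completely_positive A B \<phi>" and f: "f \<in> carrier A"
  obtains p q r s where "p \<in> carrier B" "q \<in> carrier B" "r \<in> carrier B" "s \<in> carrier B"
    and "\<phi> (alg_unit A) = star B p \<otimes> p \<oplus> star B r \<otimes> r"
    and "\<phi> f = star B p \<otimes> q \<oplus> star B r \<otimes> s"
    and "\<phi> (star A f \<otimes>\<^bsub>A\<^esub> f) = star B q \<otimes> q \<oplus> star B s \<otimes> s"
proof -
  interpret A: coordinatized_cstar_algebra A N co by fact
  interpret cstar_algebra B by fact
  \<comment> \<open>The rows of \<open>?c\<close> are the unit with \<open>f\<close>, and zero; thus
    \<open>?a\<close> is positive by construction and has the wanted entries.\<close>
  let ?c = "\<lambda>i j. if i = 0 \<and> j = 0 then alg_unit A else if i = 0 \<and> j = 1 then f else \<zero>\<^bsub>A\<^esub>"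
  let ?a = "star (mat_alg 2 A) ?c \<otimes>\<^bsub>mat_alg 2 A\<^esub> ?c"
  have c: "?c \<in> carrier (mat_alg 2 A)"
    using f A.alg_unit_closed by (auto simp: mat_alg_def)
  note a = A.mat_alg_2_star_mult[OF c]
  have a00: "?a 0 0 = alg_unit A"
    using a[of 0 0] A.alg_unit_closed by (simp add: A.star_alg_unit A.alg_unit_left)
  have a01: "?a 0 1 = f"
    using a[of 0 1] A.alg_unit_closed f by (simp add: A.star_alg_unit A.alg_unit_left)
  have a11: "?a 1 1 = star A f \<otimes>\<^bsub>A\<^esub> f"
    using a[of 1 1] f by simp
  have "?a \<in> positive_elems (mat_alg 2 A)" using c unfolding positive_elems_def by blast
  then have "(\<lambda>i j. \<phi> (?a i j)) \<in> positive_elems (mat_alg 2 B)"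
    using \<phi> unfolding completely_positive_def by blast
  then obtain b where b: "b \<in> carrier (mat_alg 2 B)"
    "(\<lambda>i j. \<phi> (?a i j)) = star (mat_alg 2 B) b \<otimes>\<^bsub>mat_alg 2 B\<^esub> b"
    unfolding positive_elems_def by blast
  have eq: "\<phi> (?a i j) = star B (b 0 i) \<otimes> b 0 j \<oplus> star B (b 1 i) \<otimes> b 1 j"
    if "i < 2" "j < 2" for i j
    using fun_cong[OF fun_cong[OF b(2)], of i j] mat_alg_2_star_mult[OF b(1) that] by simp
  have mem: "b i j \<in> carrier B" if "i < 2" "j < 2" for i j
    using b(1) that by (auto simp: mat_alg_def split: if_splits)
  show ?thesis
    by (rule that[of "b 0 0" "b 0 1" "b 1 0" "b 1 1"])
      (use mem eq[of 0 0] eq[of 0 1] eq[of 1 1] a00 a01 a11 in \<open>simp_all\<close>)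
qed

text \<open>With \<open>e = \<phi> 1\<close> and \<open>d = \<phi> f\<close>, Cauchy--Schwarz for the columns \<open>(p, r)\<close> and \<open>(q, s)\<close> gives
  \<open>\<parallel>d\<parallel>\<^sup>2 = \<parallel>d\<^sup>*p\<^sup>*q + d\<^sup>*r\<^sup>*s\<parallel> \<le> 2 \<parallel>d\<^sup>*e d\<parallel>\<^sup>1\<^sup>/\<^sup>2 \<parallel>\<phi> (f\<^sup>*f)\<parallel>\<^sup>1\<^sup>/\<^sup>2\<close>.\<close>

lemma cpc_map_norm_cube_le:
  fixes A :: "('a, 'm) normed_star_alg_scheme" and B :: "('b, 'n) normed_star_alg_scheme" (structure)
  assumes A: "cstar_algebra A" "finite_dim A" and B: "cstar_algebra B" "finite_dim B"
    and \<phi>: "cpc_map A B \<phi>" and f: "f \<in> carrier A"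
  shows "cnorm B (\<phi> f) ^ 3 \<le> 4 * (cnorm A f)\<^sup>2 * cnorm B (\<phi> (alg_unit A) \<otimes> \<phi> f)"
proof -
  obtain N co where cA: "coordinatized_cstar_algebra A N co"
    using finite_dim_coordinatized[OF A] by blast
  interpret A: coordinatized_cstar_algebra A N co by (rule cA)
  obtain N' co' where cB: "coordinatized_cstar_algebra B N' co'"
    using finite_dim_coordinatized[OF B] by blast
  interpret coordinatized_cstar_algebra B N' co' by (rule cB)
  obtain p q r s where mem: "p \<in> carrier B" "q \<in> carrier B" "r \<in> carrier B" "s \<in> carrier B"
    and e: "\<phi> (alg_unit A) = star B p \<otimes> p \<oplus> star B r \<otimes> r"
    and d: "\<phi> f = star B p \<otimes> q \<oplus> star B r \<otimes> s"
    and g: "\<phi> (star A f \<otimes>\<^bsub>A\<^esub> f) = star B q \<otimes> q \<oplus> star B s \<otimes> s"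
    using completely_positive_unit_column[OF cA B(1) _ f] \<phi> unfolding cpc_map_def by blast
  let ?e = "\<phi> (alg_unit A)" and ?d = "\<phi> f"
  have emem: "?e \<in> carrier B" and dmem: "?d \<in> carrier B" using mem by (simp_all add: e d)
  have "cnorm B (\<phi> (star A f \<otimes>\<^bsub>A\<^esub> f)) \<le> (cnorm A f)\<^sup>2"
    using \<phi> f A.cnorm_star_mult[OF f] unfolding cpc_map_def by (metis A.mult_closed A.star_closed)
  \<comment> \<open>The squares of \<open>q\<close> and \<open>s\<close> add up to the image of
    \<open>f^* f\<close>, so each is bounded by its norm; exchanging the summands covers
    \<open>s\<close>.\<close>
  then have "(cnorm B q)\<^sup>2 \<le> (cnorm A f)\<^sup>2" "(cnorm B s)\<^sup>2 \<le> (cnorm A f)\<^sup>2"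
    using cnorm_le_sum_star_mult[OF mem(2,4)] cnorm_le_sum_star_mult[OF mem(4,2)] mem
    by (simp_all add: g a_comm[of "star B s \<otimes> s"])
  then have qs: "cnorm B q \<le> cnorm A f" "cnorm B s \<le> cnorm A f"
    using power2_le_imp_le[OF _ A.cnorm_nonneg[OF f]] by blast+
  let ?t = "cnorm B ?d * cnorm B (?e \<otimes> ?d)"
  \<comment> \<open>The squares of \<open>p \<otimes> ?d\<close> and \<open>r \<otimes> ?d\<close>
    add up to \<open>d^* e d\<close>, which brings the small product \<open>?e \<otimes> ?d\<close>
    into the estimate.\<close>
  have "star B (p \<otimes> ?d) \<otimes> (p \<otimes> ?d) \<oplus> star B (r \<otimes> ?d) \<otimes> (r \<otimes> ?d) = star B ?d \<otimes> (?e \<otimes> ?d)"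
    unfolding e using mem dmem by (simp add: star_mult mult_assoc mult_l_distr mult_r_distr)
  moreover have "cnorm B (star B ?d \<otimes> (?e \<otimes> ?d)) \<le> ?t"
    using cnorm_mult[of "star B ?d" "?e \<otimes> ?d"] emem dmem by simp
  ultimately have pr2: "(cnorm B (p \<otimes> ?d))\<^sup>2 \<le> ?t" "(cnorm B (r \<otimes> ?d))\<^sup>2 \<le> ?t"
    using cnorm_le_sum_star_mult[of "p \<otimes> ?d" "r \<otimes> ?d"] cnorm_le_sum_star_mult[of "r \<otimes> ?d" "p \<otimes> ?d"]
      mem dmem by (simp_all add: a_comm[of "star B (r \<otimes> ?d) \<otimes> (r \<otimes> ?d)"])
  then have pr: "cnorm B (p \<otimes> ?d) \<le> sqrt ?t" "cnorm B (r \<otimes> ?d) \<le> sqrt ?t"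
    by (simp_all add: real_le_rsqrt)
  have "star B ?d \<otimes> ?d = star B (p \<otimes> ?d) \<otimes> q \<oplus> star B (r \<otimes> ?d) \<otimes> s"
    using mem dmem d by (simp add: star_mult mult_assoc mult_r_distr[symmetric])
  then have "(cnorm B ?d)\<^sup>2 \<le> cnorm B (star B (p \<otimes> ?d) \<otimes> q) + cnorm B (star B (r \<otimes> ?d) \<otimes> s)"
    using cnorm_star_mult[OF dmem] mem dmem
      cnorm_triangle[of "star B (p \<otimes> ?d) \<otimes> q" "star B (r \<otimes> ?d) \<otimes> s"] by simp
  also have "\<dots> \<le> cnorm B (p \<otimes> ?d) * cnorm B q + cnorm B (r \<otimes> ?d) * cnorm B s"
    using cnorm_mult[of "star B (p \<otimes> ?d)" q] cnorm_mult[of "star B (r \<otimes> ?d)" s] mem dmem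
    by (simp add: add_mono)
  also have "\<dots> \<le> sqrt ?t * cnorm A f + sqrt ?t * cnorm A f"
    using pr qs mem emem dmem cnorm_nonneg by (intro add_mono mult_mono) auto
  \<comment> \<open>Squaring once more removes the root. A factor \<open>cnorm B ?d\<close> then
    stands on both sides; cancelling it leaves the cube.\<close>
  finally have "((cnorm B ?d)\<^sup>2)\<^sup>2 \<le> (2 * cnorm A f * sqrt ?t)\<^sup>2"
    by (intro power_mono) (auto simp: mult_ac)
  also have "\<dots> = 4 * (cnorm A f)\<^sup>2 * ?t"
    using emem dmem cnorm_nonneg by (simp add: power_mult_distrib)
  finally have "cnorm B ?d * cnorm B ?d ^ 3 \<le> cnorm B ?d * (4 * (cnorm A f)\<^sup>2 * cnorm B (?e \<otimes> ?d))"
    by (simp add: power2_eq_square power3_eq_cube mult_ac)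
  then show ?thesis
    using cnorm_nonneg[OF dmem] cnorm_nonneg[of "?e \<otimes> ?d"] emem dmem
    by (cases "cnorm B ?d = 0") auto
qed

section \<open>Connecting maps as c.p.c. maps\<close>

lemma cpc_map_id: "cpc_map A A id"
  unfolding cpc_map_def completely_positive_def Defs.linear_map_def by auto

lemma cpc_map_comp:
  assumes "cpc_map A B \<phi>" "cpc_map B C \<psi>"
  shows "cpc_map A C (\<psi> \<circ> \<phi>)"
  unfolding cpc_map_def
proof
  have cl: "\<phi> x \<in> carrier B" if "x \<in> carrier A" for x
    using assms(1) that by (auto simp: cpc_map_def completely_positive_def Defs.linear_map_def)
  show "completely_positive A C (\<psi> \<circ> \<phi>)"
    unfolding completely_positive_def
  proof
    show "Defs.linear_map A C (\<psi> \<circ> \<phi>)"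
      using assms cl by (auto simp: cpc_map_def completely_positive_def Defs.linear_map_def Pi_iff)
    show "\<forall>r. \<forall>a\<in>positive_elems (mat_alg r A). (\<lambda>i j. (\<psi> \<circ> \<phi>) (a i j)) \<in> positive_elems (mat_alg r C)"
    proof (intro allI ballI)
      fix r a assume "a \<in> positive_elems (mat_alg r A)"
      then have "(\<lambda>i j. \<phi> (a i j)) \<in> positive_elems (mat_alg r B)"
        using assms(1) by (simp add: cpc_map_def completely_positive_def)
      moreover have "\<forall>b\<in>positive_elems (mat_alg r B). (\<lambda>i j. \<psi> (b i j)) \<in> positive_elems (mat_alg r C)"
        using assms(2) by (simp add: cpc_map_def completely_positive_def)
      ultimately show "(\<lambda>i j. (\<psi> \<circ> \<phi>) (a i j)) \<in> positive_elems (mat_alg r C)" by fastforce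
    qed
  qed
  show "\<forall>x\<in>carrier A. cnorm C ((\<psi> \<circ> \<phi>) x) \<le> cnorm A x"
    using assms cl unfolding cpc_map_def comp_def by (meson order_trans)
qed

lemma connecting_self [simp]: "connecting \<rho> n n = id"
  by (cases n) auto

lemma connecting_comp:
  assumes "k \<le> n" "n \<le> m"
  shows "connecting \<rho> m n (connecting \<rho> n k x) = connecting \<rho> m k x"
  using assms(2)
proof (induction m rule: dec_induct)
  case (step m)
  then show ?case using assms(1) by simp
qed simp

lemma cpc_map_connecting:
  assumes "cpc_system F \<rho>" "n \<le> m"
  shows "cpc_map (F n) (F m) (connecting \<rho> m n)"
  using assms(2)
proof (induction m rule: dec_induct)
  case base
  show ?case unfolding connecting_self by (rule cpc_map_id)
next
  case (step m)
  have "connecting \<rho> (Suc m) n = \<rho> m \<circ> connecting \<rho> m n" using step.hyps by simp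
  moreover have "cpc_map (F m) (F (Suc m)) (\<rho> m)" using assms(1) by (simp add: cpc_system_def)
  ultimately show ?case using cpc_map_comp[OF step.IH] by (simp only:)
qed

section \<open>From the CPC*-condition to the encoding condition\<close>

text \<open>The cube estimate is applied to the connecting map from \<open>F j\<close> to
  \<open>F m\<close> and to the difference \<open>f\<close>, formed already in \<open>F j\<close>;
  this is where \<open>n \<le> j\<close> enters. Both instances of \<open>close\<close> use the same
  unit, so subtracting them cancels the product in \<open>F m\<close>. The constant 32 is 4 * 2^2 *
  2: one 2 bounds \<open>f\<close>, the other comes from adding two errors
  \<open>\<delta>\<close>.\<close>

lemma CPC_star_system_norm_cube_le:
  assumes F: "cpc_system F \<rho>" and fin: "\<And>n. finite_dim (F n)"
    and x: "x \<in> carrier (F k)" and y: "y \<in> carrier (F k)"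
    and "k \<le> n" "n \<le> j" "j \<le> m"
    and close: "\<And>i. i \<in> {n, j} \<Longrightarrow> cnorm (F m)
          (connecting \<rho> m k x \<otimes>\<^bsub>F m\<^esub> connecting \<rho> m k y
           \<ominus>\<^bsub>F m\<^esub> connecting \<rho> m j (alg_unit (F j))
              \<otimes>\<^bsub>F m\<^esub> connecting \<rho> m i (connecting \<rho> i k x \<otimes>\<^bsub>F i\<^esub> connecting \<rho> i k y)) < \<delta>"
  shows "cnorm (F m)
          (connecting \<rho> m n (connecting \<rho> n k x \<otimes>\<^bsub>F n\<^esub> connecting \<rho> n k y)
           \<ominus>\<^bsub>F m\<^esub> connecting \<rho> m j (connecting \<rho> j k x \<otimes>\<^bsub>F j\<^esub> connecting \<rho> j k y)) ^ 3
    \<le> 32 * (cnorm (F k) x * cnorm (F k) y)\<^sup>2 * \<delta>"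
proof -
  have cstar: "cstar_algebra (F i)" for i using F by (simp add: cpc_system_def)
  interpret m: cstar_algebra "F m" by (rule cstar)
  interpret j: cstar_algebra "F j" by (rule cstar)
  interpret k: cstar_algebra "F k" by (rule cstar)
  let ?\<rho> = "connecting \<rho>"
  define a where "a i = ?\<rho> i k x \<otimes>\<^bsub>F i\<^esub> ?\<rho> i k y" for i
  have lin: "Defs.linear_map (F i) (F l) (?\<rho> l i)" and contr: "\<And>z. z \<in> carrier (F i) \<Longrightarrow> cnorm (F l) (?\<rho> l i z) \<le> cnorm (F i) z"
    if "i \<le> l" for i l
    using cpc_map_connecting[OF F that] by (auto simp: cpc_map_def completely_positive_def)
  have cl: "?\<rho> l i z \<in> carrier (F l)" if "i \<le> l" "z \<in> carrier (F i)" for i l z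
    using lin[OF that(1)] that(2) by (auto simp: Defs.linear_map_def)
  have a_cl: "a i \<in> carrier (F i)" and a_norm: "cnorm (F i) (a i) \<le> cnorm (F k) x * cnorm (F k) y"
    if "k \<le> i" for i
  proof -
    interpret i: cstar_algebra "F i" by (rule cstar)
    show "a i \<in> carrier (F i)" using cl[OF that] x y by (simp add: a_def)
    have "cnorm (F i) (a i) \<le> cnorm (F i) (?\<rho> i k x) * cnorm (F i) (?\<rho> i k y)"
      unfolding a_def using cl[OF that] x y by (intro i.cnorm_mult) auto
    also have "\<dots> \<le> cnorm (F k) x * cnorm (F k) y"
      using contr[OF that] cl[OF that] x y by (intro mult_mono i.cnorm_nonneg k.cnorm_nonneg) auto
    finally show "cnorm (F i) (a i) \<le> cnorm (F k) x * cnorm (F k) y" .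
  qed
  have "k \<le> j" "n \<le> m" using assms by auto
  define f where "f = ?\<rho> j n (a n) \<ominus>\<^bsub>F j\<^esub> a j"
  define e where "e = ?\<rho> m j (alg_unit (F j))"
  have f: "f \<in> carrier (F j)"
    unfolding f_def using a_cl cl \<open>k \<le> n\<close> \<open>n \<le> j\<close> \<open>k \<le> j\<close> by simp
  have "cnorm (F j) f \<le> cnorm (F j) (?\<rho> j n (a n)) + cnorm (F j) (a j)"
    unfolding f_def using a_cl cl \<open>k \<le> n\<close> \<open>n \<le> j\<close> \<open>k \<le> j\<close> by (intro j.cnorm_diff_triangle) auto
  also have "\<dots> \<le> 2 * (cnorm (F k) x * cnorm (F k) y)"
    using contr[OF \<open>n \<le> j\<close> a_cl[OF \<open>k \<le> n\<close>]] a_norm[OF \<open>k \<le> n\<close>] a_norm[OF \<open>k \<le> j\<close>] by simp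
  finally have f_norm: "cnorm (F j) f \<le> 2 * (cnorm (F k) x * cnorm (F k) y)" .
  let ?u = "?\<rho> m n (a n)" and ?v = "?\<rho> m j (a j)"
  have uv: "?u \<in> carrier (F m)" "?v \<in> carrier (F m)"
    using a_cl cl \<open>k \<le> n\<close> \<open>n \<le> m\<close> \<open>k \<le> j\<close> \<open>j \<le> m\<close> by auto
  have d: "?\<rho> m j f = ?u \<ominus>\<^bsub>F m\<^esub> ?v"
    using lin[OF \<open>j \<le> m\<close>] a_cl cl \<open>k \<le> n\<close> \<open>n \<le> j\<close> \<open>k \<le> j\<close> uv
    by (simp add: f_def j.diff_conv_scale m.diff_conv_scale Defs.linear_map_def
        connecting_comp[OF \<open>n \<le> j\<close> \<open>j \<le> m\<close>])
  obtain N co where "coordinatized_cstar_algebra (F j) N co"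
    using finite_dim_coordinatized[OF cstar fin] by blast
  then have "alg_unit (F j) \<in> carrier (F j)" by (rule coordinatized_cstar_algebra.alg_unit_closed)
  then have e: "e \<in> carrier (F m)" unfolding e_def using cl[OF \<open>j \<le> m\<close>] by blast
  define w where "w = ?\<rho> m k x \<otimes>\<^bsub>F m\<^esub> ?\<rho> m k y"
  have w: "w \<in> carrier (F m)"
    unfolding w_def using cl[of k m] x y \<open>k \<le> n\<close> \<open>n \<le> m\<close> by simp
  have "e \<otimes>\<^bsub>F m\<^esub> (?u \<ominus>\<^bsub>F m\<^esub> ?v)
      = (w \<ominus>\<^bsub>F m\<^esub> e \<otimes>\<^bsub>F m\<^esub> ?v) \<ominus>\<^bsub>F m\<^esub> (w \<ominus>\<^bsub>F m\<^esub> e \<otimes>\<^bsub>F m\<^esub> ?u)"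
  proof -
    have "(w \<ominus>\<^bsub>F m\<^esub> e \<otimes>\<^bsub>F m\<^esub> ?v) \<ominus>\<^bsub>F m\<^esub> (w \<ominus>\<^bsub>F m\<^esub> e \<otimes>\<^bsub>F m\<^esub> ?u)
      = (w \<oplus>\<^bsub>F m\<^esub> (- 1) \<odot>\<^bsub>F m\<^esub> w) \<oplus>\<^bsub>F m\<^esub> (e \<otimes>\<^bsub>F m\<^esub> ?u \<oplus>\<^bsub>F m\<^esub> (- 1) \<odot>\<^bsub>F m\<^esub> (e \<otimes>\<^bsub>F m\<^esub> ?v))"
      using w e uv by (simp add: m.diff_conv_scale m.scale_add_right m.scale_scale m.a_ac)
    also have "\<dots> = e \<otimes>\<^bsub>F m\<^esub> (?u \<ominus>\<^bsub>F m\<^esub> ?v)"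
      using w e uv
      by (simp add: m.scale_minus_one m.r_neg)
        (simp add: m.diff_conv_scale m.mult_r_distr m.smult_mult_r m.scale_minus_one[symmetric])
    finally show ?thesis ..
  qed
  then have "cnorm (F m) (e \<otimes>\<^bsub>F m\<^esub> ?\<rho> m j f) \<le> 2 * \<delta>"
    using close[of n] close[of j] w e uv
      m.cnorm_diff_triangle[of "w \<ominus>\<^bsub>F m\<^esub> e \<otimes>\<^bsub>F m\<^esub> ?v" "w \<ominus>\<^bsub>F m\<^esub> e \<otimes>\<^bsub>F m\<^esub> ?u"]
    unfolding d w_def e_def a_def by simp
  moreover have "cnorm (F m) (?\<rho> m j f) ^ 3
      \<le> 4 * (cnorm (F j) f)\<^sup>2 * cnorm (F m) (e \<otimes>\<^bsub>F m\<^esub> ?\<rho> m j f)"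
    unfolding e_def
    by (rule cpc_map_norm_cube_le[OF cstar fin cstar fin cpc_map_connecting[OF F \<open>j \<le> m\<close>] f])
  moreover have "(cnorm (F j) f)\<^sup>2 \<le> (2 * (cnorm (F k) x * cnorm (F k) y))\<^sup>2"
    using f_norm j.cnorm_nonneg[OF f] by (rule power_mono)
  moreover have "0 \<le> cnorm (F m) (e \<otimes>\<^bsub>F m\<^esub> ?\<rho> m j f)"
    using e f cl[OF \<open>j \<le> m\<close>] by (intro m.cnorm_nonneg) auto
  ultimately have "cnorm (F m) (?\<rho> m j f) ^ 3
      \<le> 4 * (2 * (cnorm (F k) x * cnorm (F k) y))\<^sup>2 * (2 * \<delta>)"
    by (smt (verit) mult_mono zero_le_power2)
  also have "\<dots> = 32 * (cnorm (F k) x * cnorm (F k) y)\<^sup>2 * \<delta>" by (simp add: power_mult_distrib)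
  finally show ?thesis unfolding d a_def .
qed

theorem corollary3p10:
  fixes F :: "nat \<Rightarrow> 'a normed_star_alg" and \<rho> :: "nat \<Rightarrow> 'a \<Rightarrow> 'a"
  assumes "CPC_star_system F \<rho>"
  shows "\<exists>s :: nat \<Rightarrow> nat. strict_mono s \<and>
           Cstar_encoding (\<lambda>i. F (s i)) (\<lambda>i. connecting \<rho> (s (Suc i)) (s i))"
proof -
  have F: "cpc_system F \<rho>" and fin: "\<And>n. finite_dim (F n)"
    using assms by (simp_all add: CPC_star_system_def)
  have cstar: "cstar_algebra (F i)" for i using F by (simp add: cpc_system_def)
  let ?\<rho> = "connecting \<rho>"
  have "Cstar_encoding F \<rho>"
    unfolding Cstar_encoding_def
  proof (intro conjI allI ballI impI)
    fix k x y and \<epsilon> :: real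
    assume x: "x \<in> carrier (F k)" and y: "y \<in> carrier (F k)" and "0 < \<epsilon>"
    define K where "K = (cnorm (F k) x * cnorm (F k) y)\<^sup>2"
    \<comment> \<open>Chosen to make the cube bound smaller than \<open>\<epsilon> ^ 3\<close>;
      \<open>K + 1\<close> keeps the denominator positive when \<open>K = 0\<close> and makes the
      inequality strict.\<close>
    define \<delta> where "\<delta> = \<epsilon> ^ 3 / (32 * (K + 1))"
    have "0 \<le> K" by (simp add: K_def)
    have "0 < \<delta>" using \<open>0 < \<epsilon>\<close> \<open>0 \<le> K\<close> by (simp add: \<delta>_def)
    have "32 * K * \<delta> = \<epsilon> ^ 3 * (K / (K + 1))" using \<open>0 \<le> K\<close> by (simp add: \<delta>_def field_simps)
    also have "\<dots> < \<epsilon> ^ 3 * 1"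
      using \<open>0 < \<epsilon>\<close> \<open>0 \<le> K\<close> by (intro mult_strict_left_mono) auto
    finally have \<delta>: "32 * K * \<delta> < \<epsilon> ^ 3" by simp
    obtain M where M: "k < M" and close: "\<And>n j m. M < n \<Longrightarrow> M < j \<Longrightarrow> max n j < m \<Longrightarrow>
        cnorm (F m) (?\<rho> m k x \<otimes>\<^bsub>F m\<^esub> ?\<rho> m k y \<ominus>\<^bsub>F m\<^esub> ?\<rho> m j (alg_unit (F j))
              \<otimes>\<^bsub>F m\<^esub> ?\<rho> m n (?\<rho> n k x \<otimes>\<^bsub>F n\<^esub> ?\<rho> n k y)) < \<delta>"
      using assms x y \<open>0 < \<delta>\<close> unfolding CPC_star_system_def by meson
    let ?z = "\<lambda>m n. ?\<rho> m n (?\<rho> n k x \<otimes>\<^bsub>F n\<^esub> ?\<rho> n k y)"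
    \<comment> \<open>The two products are first compared in the later algebra \<open>F j\<close>,
      hence \<open>n \<le> j\<close>; the opposite order follows from the symmetry of the
      norm.\<close>
    have less: "cnorm (F m) (?z m n \<ominus>\<^bsub>F m\<^esub> ?z m j) < \<epsilon>" if "M < n" "n \<le> j" "j < m" for n j m
    proof -
      have "cnorm (F m) (?z m n \<ominus>\<^bsub>F m\<^esub> ?z m j) ^ 3 \<le> 32 * K * \<delta>"
        unfolding K_def using M that close
        by (intro CPC_star_system_norm_cube_le[OF F fin x y]) auto
      then have "cnorm (F m) (?z m n \<ominus>\<^bsub>F m\<^esub> ?z m j) ^ 3 < \<epsilon> ^ 3" using \<delta> by simp
      then show ?thesis by (rule power_less_imp_less_base) (use \<open>0 < \<epsilon>\<close> in simp)
    qed
    have z: "?z m n \<in> carrier (F m)" if "k \<le> n" "n \<le> m" for m n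
    proof -
      have "?\<rho> l i \<in> carrier (F i) \<rightarrow> carrier (F l)" if "i \<le> l" for i l
        using cpc_map_connecting[OF F that]
        by (simp add: cpc_map_def completely_positive_def Defs.linear_map_def)
      then show ?thesis using that x y cstar_algebra.mult_closed[OF cstar] by (metis funcset_mem)
    qed
    have "cnorm (F m) (?z m n \<ominus>\<^bsub>F m\<^esub> ?z m j) < \<epsilon>" if "M < n" "M < j" "max n j < m" for n j m
    proof (cases "n \<le> j")
      case True
      then show ?thesis using less that by simp
    next
      case False
      then show ?thesis
        using less[of j n m] that M z[of n m] z[of j m] cstar_algebra.cnorm_diff_commute[OF cstar]
        by simp
    qed
    then show "\<exists>M>k. \<forall>n>M. \<forall>j>M. \<forall>m>max n j. cnorm (F m) (?z m n \<ominus>\<^bsub>F m\<^esub> ?z m j) < \<epsilon>"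
      using M by blast
  qed (rule F)
  \<comment> \<open>Along the identity sequence the one-step connecting maps are the original ones,
    so the system is a subsystem of itself.\<close>
  moreover have "(\<lambda>i. connecting \<rho> (Suc i) i) = \<rho>" by auto
  ultimately show ?thesis by (intro exI[of _ "\<lambda>i. i"]) (simp add: strict_mono_def)
qed

end
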